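(* There exists a quasiregular mapping of transcendental type $F:\mathbb{R}^3\to\mathbb{R}^3$ such that, for $x\in\mathbb{R}^3$, $F(x)=0$ if and only if $x=0$.
   Context: Let $d\ge 2$ and let $G\subset\mathbb{R}^d$ be a domain. A continuous map $f:G\to\mathbb{R}^d$ in the Sobolev space $W^{1}_{d,\mathrm{loc}}(G)$ (first order weak partial derivatives exist and are locally in $L^d$) is quasiregular if there is a constant $K\ge 1$ such that $\left(\sup_{|h|=1}|Df(x)(h)|\right)^d\le K J_f(x)$ for almost every $x\in G$, where $Df(x)$ is the formal derivative and $J_f(x)$ its Jacobian determinant. A quasiregular map $f:\mathbb{R}^d\to\mathbb{R}^d$ is of transcendental type if it has an essential singularity at infinity, i.e. $f(x)$ has no limit in $\hat{\mathbb{R}}^d=\mathbb{R}^d\cup\{\infty\}$ as $x\to\infty$. *)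

theory Defs
  imports "HOL-Analysis.Analysis"
begin

text \<open>
  \<open>differentiable_times k f\<close>: \<open>f\<close> is of class \<open>C\<^sup>k\<close> on the whole space.
\<close>

primrec differentiable_times :: "nat \<Rightarrow> ('a::euclidean_space \<Rightarrow> real) \<Rightarrow> bool" where
  "differentiable_times 0 f \<longleftrightarrow> continuous_on UNIV f"
| "differentiable_times (Suc k) f \<longleftrightarrow>
     (\<exists>f'. (\<forall>x. (f has_derivative f' x) (at x)) \<and>
           (\<forall>b\<in>Basis. differentiable_times k (\<lambda>x. f' x b)))"

definition smooth :: "('a::euclidean_space \<Rightarrow> real) \<Rightarrow> bool" where
  "smooth f \<longleftrightarrow> (\<forall>k. differentiable_times k f)"

definition test_function :: "'a::euclidean_space set \<Rightarrow> ('a \<Rightarrow> real) \<Rightarrow> bool" where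
  "test_function G \<phi> \<longleftrightarrow>
     smooth \<phi> \<and> compact (closure {x. \<phi> x \<noteq> 0}) \<and> closure {x. \<phi> x \<noteq> 0} \<subseteq> G"

text \<open>
  Natural exponents \<open>p \<ge> 1\<close> suffice here, since only \<open>p = 1\<close> and \<open>p = d\<close> occur.
\<close>

definition locally_Lp :: "nat \<Rightarrow> 'a::euclidean_space set \<Rightarrow> ('a \<Rightarrow> real) \<Rightarrow> bool" where
  "locally_Lp p G u \<longleftrightarrow>
     (\<forall>K. compact K \<and> K \<subseteq> G \<longrightarrow>
        set_borel_measurable lebesgue K u \<and> set_integrable lebesgue K (\<lambda>x. \<bar>u x\<bar> ^ p))"

text \<open>
  \<open>weak_partial G b u v\<close>: \<open>v\<close> is the weak derivative of \<open>u\<close> on \<open>G\<close> in direction \<open>b\<close>.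
\<close>

definition weak_partial ::
  "'a::euclidean_space set \<Rightarrow> 'a \<Rightarrow> ('a \<Rightarrow> real) \<Rightarrow> ('a \<Rightarrow> real) \<Rightarrow> bool" where
  "weak_partial G b u v \<longleftrightarrow>
     locally_Lp 1 G u \<and> locally_Lp 1 G v \<and>
     (\<forall>\<phi>. test_function G \<phi> \<longrightarrow>
        (LINT x:G|lebesgue. u x * frechet_derivative \<phi> (at x) b) =
        - (LINT x:G|lebesgue. v x * \<phi> x))"

definition sobolev_1_loc :: "nat \<Rightarrow> 'a::euclidean_space set \<Rightarrow> ('a \<Rightarrow> real) \<Rightarrow> bool" where
  "sobolev_1_loc p G u \<longleftrightarrow>
     locally_Lp p G u \<and>
     (\<forall>b\<in>Basis. \<exists>v. weak_partial G b u v \<and> locally_Lp p G v)"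

text \<open>
  \<open>D x\<close> is the matrix of weak partial derivatives at \<open>x\<close>; as a function of \<open>x\<close> it is determined
  by \<open>f\<close> only up to a null subset of \<open>G\<close>.
\<close>

definition formal_derivative ::
  "(real^'n) set \<Rightarrow> (real^'n \<Rightarrow> real^'n) \<Rightarrow> (real^'n \<Rightarrow> real^'n^'n) \<Rightarrow> bool" where
  "formal_derivative G f D \<longleftrightarrow>
     (\<forall>i j. weak_partial G (axis j 1) (\<lambda>x. f x $ i) (\<lambda>x. D x $ i $ j))"

definition quasiregular_on :: "(real^'n) set \<Rightarrow> (real^'n \<Rightarrow> real^'n) \<Rightarrow> bool" where
  "quasiregular_on G f \<longleftrightarrow>
     CARD('n) \<ge> 2 \<and> open G \<and> connected G \<and> G \<noteq> {} \<and>
     continuous_on G f \<and>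
     (\<forall>i. sobolev_1_loc CARD('n) G (\<lambda>x. f x $ i)) \<and>
     (\<exists>K\<ge>1. \<exists>D. formal_derivative G f D \<and>
        (AE x in lebesgue. x \<in> G \<longrightarrow>
           (SUP h\<in>sphere 0 1. norm (D x *v h)) ^ CARD('n) \<le> K * det (D x)))"

text \<open>
  The one-point compactification of the space has underlying type \<open>(real^'n) option\<close>, with
  \<open>None\<close> as the point at infinity.
\<close>

definition transcendental_type :: "(real^'n \<Rightarrow> real^'n) \<Rightarrow> bool" where
  "transcendental_type f \<longleftrightarrow>
     (\<nexists>l. limitin (Alexandroff_compactification euclidean) (\<lambda>x. Some (f x)) l at_infinity)"

end

theory Submission
  imports Defs
begin

text \<open>
  The map is a three-dimensional analogue of \<open>z \<mapsto> z e\<^sup>z\<close>. Tile the plane by the mirror images of the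
  triangle \<open>B\<close> with vertices \<open>(0, -1)\<close>, \<open>(0, 1)\<close>, \<open>(1, 0)\<close>, and fold it onto the boundary of a
  bipyramid over \<open>B\<close>, neighbouring triangles going to opposite pyramids. If \<open>\<zeta>\<close> denotes this
  folding, then \<open>e\<^sup>t \<zeta>(x, y)\<close> is a Zorich map, which omits \<open>0\<close>. On the half-space \<open>x \<ge> 0\<close> we
  precompose it with a shear in the \<open>x\<close>-direction that opens up a gap below the triangle \<open>B\<close>: for
  very negative \<open>t\<close> the shear pushes the plane \<open>x = 0\<close> onto the two short sides of \<open>B\<close>, which are
  mirrors just like its long side. The beam over \<open>B\<close> that is cut off in this way is replaced
  by a small region \<open>|x| < \<eta>(y, t)\<close> around the origin, on which the map is
  \<open>e\<^sup>t (-t, y, x)\<close> and has its only zero. The plane \<open>x = 0\<close> is mapped into a plane, and reflection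
  extends the map to the whole space.

  Off a null set the map is locally \<open>e\<^sup>t\<close> times an affine map. Its Jacobian is \<open>e\<^sup>3\<^sup>t\<close> times a
  determinant which a shear in the \<open>x\<close>-direction does not change and which is at least \<open>1/2\<close>, whereas
  the entries of the derivative are bounded by a multiple of \<open>e\<^sup>t\<close>.
\<close>

section \<open>Weak derivatives of locally Lipschitz functions\<close>

text \<open>The constant serves a whole ball rather than a neighbourhood of one point, so that
  difference quotients are bounded uniformly on compact sets.\<close>

definition locally_lipschitz :: "('a::euclidean_space \<Rightarrow> real) \<Rightarrow> bool" where
  "locally_lipschitz u \<longleftrightarrow>
     (\<forall>R. \<exists>L. \<forall>x\<in>cball 0 R. \<forall>y\<in>cball 0 R. \<bar>u x - u y\<bar> \<le> L * norm (x - y))"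

lemma locally_lipschitzD:
  assumes "locally_lipschitz u"
  shows "\<exists>L\<ge>0. \<forall>x y. norm x \<le> R \<longrightarrow> norm y \<le> R \<longrightarrow> \<bar>u x - u y\<bar> \<le> L * norm (x - y)"
proof -
  obtain L where L: "\<forall>x\<in>cball 0 R. \<forall>y\<in>cball 0 R. \<bar>u x - u y\<bar> \<le> L * norm (x - y)"
    using assms unfolding locally_lipschitz_def by blast
  have "\<bar>u x - u y\<bar> \<le> \<bar>L\<bar> * norm (x - y)" if "norm x \<le> R" "norm y \<le> R" for x y
  proof -
    have "\<bar>u x - u y\<bar> \<le> L * norm (x - y)"
      using L that by simp
    also have "\<dots> \<le> \<bar>L\<bar> * norm (x - y)"
      by (intro mult_right_mono) auto
    finally show ?thesis .
  qed
  then show ?thesis by (intro exI[of _ "\<bar>L\<bar>"]) auto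
qed

lemma locally_lipschitz_imp_continuous_on:
  assumes "locally_lipschitz u"
  shows "continuous_on UNIV u"
proof (rule continuous_at_imp_continuous_on, intro ballI)
  fix x :: 'a
  obtain L where L: "L \<ge> 0"
    "\<forall>y z. norm y \<le> norm x + 1 \<longrightarrow> norm z \<le> norm x + 1 \<longrightarrow> \<bar>u y - u z\<bar> \<le> L * norm (y - z)"
    using locally_lipschitzD[OF assms, of "norm x + 1"] by blast
  have ev: "\<forall>\<^sub>F y in at x. norm (u y - u x) \<le> L * norm (y - x)"
    unfolding eventually_at
  proof (intro exI[of _ 1] conjI ballI impI)
    fix y assume "y \<noteq> x \<and> dist y x < 1"
    then have "norm y \<le> norm x + 1"
      using norm_triangle_sub[of y x] by (simp add: dist_norm)
    then show "norm (u y - u x) \<le> L * norm (y - x)"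
      using L(2)[rule_format, of y x] by simp
  qed simp
  have "((\<lambda>y. L * norm (y - x)) \<longlongrightarrow> L * norm (x - x)) (at x)"
    by (intro tendsto_intros)
  then have "((\<lambda>y. L * norm (y - x)) \<longlongrightarrow> 0) (at x)" by simp
  from Lim_null_comparison[OF ev this] show "isCont u x"
    unfolding isCont_def by (simp add: LIM_zero_iff)
qed

lemma locally_lipschitz_bounded_on_ball:
  assumes "locally_lipschitz u"
  shows "\<exists>B\<ge>0. \<forall>x. norm x \<le> R \<longrightarrow> \<bar>u x\<bar> \<le> B"
proof -
  have "compact (u ` cball 0 R)"
    using locally_lipschitz_imp_continuous_on[OF assms]
    by (intro compact_continuous_image) (auto intro: continuous_on_subset)
  then have "bounded (u ` cball 0 R)" by (rule compact_imp_bounded)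
  then obtain B where "\<forall>x\<in>cball 0 R. \<bar>u x\<bar> \<le> B"
    by (auto simp: bounded_iff)
  then have "\<forall>x. norm x \<le> R \<longrightarrow> \<bar>u x\<bar> \<le> \<bar>B\<bar>"
    by (metis abs_ge_self mem_cball_0 order_trans)
  then show ?thesis by (intro exI[of _ "\<bar>B\<bar>"]) auto
qed

text \<open>The limit runs along the steps \<open>1 / (n + 1)\<close> only: as a pointwise
  \<open>lim\<close> of a sequence of Borel functions it is Borel measurable, whether or not the
  quotients converge everywhere.\<close>

definition directional_derivative :: "('a::euclidean_space \<Rightarrow> real) \<Rightarrow> 'a \<Rightarrow> 'a \<Rightarrow> real" where
  "directional_derivative u b x = lim (\<lambda>n. (u (x + b /\<^sub>R real (Suc n)) - u x) * real (Suc n))"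

lemma difference_quotient_tendsto:
  assumes "(u has_derivative D) (at x)"
  shows "(\<lambda>n. (u (x + b /\<^sub>R real (Suc n)) - u x) * real (Suc n)) \<longlonglongrightarrow> (D b :: real)"
proof -
  interpret bounded_linear D using assms by (rule has_derivative_bounded_linear)
  have "((\<lambda>s. u (x + s *\<^sub>R b)) has_derivative (\<lambda>s. D (s *\<^sub>R b))) (at 0)"
  proof (rule has_derivative_compose[of "\<lambda>s. x + s *\<^sub>R b" "\<lambda>s. s *\<^sub>R b" 0 UNIV u])
    show "((\<lambda>s. x + s *\<^sub>R b) has_derivative (\<lambda>s. s *\<^sub>R b)) (at 0)"
      by (auto intro!: derivative_eq_intros)
  qed (use assms in simp)
  then have "((\<lambda>s. u (x + s *\<^sub>R b)) has_field_derivative D b) (at 0)"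
    unfolding has_field_derivative_def
    by (rule back_subst[where P="\<lambda>g. (_ has_derivative g) _"]) (auto simp: scaleR)
  then have *: "((\<lambda>h. (u (x + h *\<^sub>R b) - u x) / h) \<longlongrightarrow> D b) (at 0)"
    by (simp add: DERIV_def)
  have "(\<lambda>n. (u (x + inverse (real (Suc n)) *\<^sub>R b) - u x) / inverse (real (Suc n))) \<longlonglongrightarrow> D b"
  proof (rule filterlim_compose[OF *])
    show "filterlim (\<lambda>n. inverse (real (Suc n))) (at 0) sequentially"
      using LIMSEQ_inverse_real_of_nat by (simp add: filterlim_at)
  qed
  then show ?thesis by (simp add: divide_inverse)
qed

lemma integrable_lebesgue_if_bounded_on_cball:
  fixes f :: "'a::euclidean_space \<Rightarrow> real"
  assumes "f \<in> borel_measurable lebesgue"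
    and "AE x in lebesgue. \<bar>f x\<bar> \<le> B * indicator (cball 0 R) x"
  shows "integrable lebesgue f"
proof (rule Bochner_Integration.integrable_bound)
  have "emeasure lebesgue (cball 0 R :: 'a set) < \<infinity>"
    using emeasure_bounded_finite[of "cball 0 R :: 'a set"] by (simp add: less_top)
  then show "integrable lebesgue (\<lambda>x::'a. B * indicator (cball 0 R) x)"
    by (intro integrable_mult_right integrable_real_indicator) (simp_all add: less_top)
  show "AE x in lebesgue. norm (f x) \<le> norm (B * indicator (cball 0 R) x)"
    using assms(2) by eventually_elim auto
qed (rule assms)

text \<open>The bound is asked for only almost everywhere, because a limit of difference quotients
  is controlled only where it exists.\<close>

lemma locally_Lp_if_AE_locally_bounded:
  fixes u :: "'a::euclidean_space \<Rightarrow> real"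
  assumes u: "u \<in> borel_measurable lebesgue"
    and bd: "\<And>R. \<exists>B\<ge>0. AE x in lebesgue. norm x \<le> R \<longrightarrow> \<bar>u x\<bar> \<le> B"
  shows "locally_Lp k UNIV u"
  unfolding locally_Lp_def
proof (intro allI impI conjI)
  fix K :: "'a set" assume "compact K \<and> K \<subseteq> UNIV"
  then have K: "compact K" by simp
  then have [measurable]: "K \<in> sets lebesgue"
    by (simp add: borel_compact)
  note u[measurable]
  show "set_borel_measurable lebesgue K u"
    unfolding set_borel_measurable_def by measurable
  obtain R where R: "\<And>x. x \<in> K \<Longrightarrow> norm x \<le> R"
    using compact_imp_bounded[OF K] by (auto simp: bounded_iff)
  obtain B where B: "B \<ge> 0" "AE x in lebesgue. norm x \<le> R \<longrightarrow> \<bar>u x\<bar> \<le> B"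
    using bd by blast
  show "set_integrable lebesgue K (\<lambda>x. \<bar>u x\<bar> ^ k)"
    unfolding set_integrable_def
  proof (rule integrable_lebesgue_if_bounded_on_cball[of _ "B ^ k" R])
    show "(\<lambda>x. indicat_real K x *\<^sub>R \<bar>u x\<bar> ^ k) \<in> borel_measurable lebesgue"
      by measurable
    show "AE x in lebesgue. \<bar>indicat_real K x *\<^sub>R \<bar>u x\<bar> ^ k\<bar> \<le> B ^ k * indicator (cball 0 R) x"
      using B(2)
    proof eventually_elim
      case (elim x)
      show ?case
      proof (cases "x \<in> K")
        case True
        with R elim have "norm x \<le> R" "\<bar>u x\<bar> \<le> B" by blast+
        then show ?thesis using True by (simp add: power_mono)
      qed (use B(1) in simp)
    qed
  qed
qed

lemma integral_lebesgue_translation: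
  fixes f :: "'a::euclidean_space \<Rightarrow> real"
  assumes [measurable]: "f \<in> borel_measurable borel"
  shows "(LINT x|lebesgue. f (x + c)) = (LINT x|lebesgue. f x)"
proof -
  have "(LINT x|lebesgue. f (x + c)) = (LINT x|lborel. f (c + x))"
    by (subst integral_completion) (auto simp: add.commute)
  also have "\<dots> = (LINT x|distr lborel borel ((+) c). f x)"
    by (subst integral_distr) auto
  also have "\<dots> = (LINT x|lebesgue. f x)"
    by (subst lborel_distr_plus, subst integral_completion) auto
  finally show ?thesis .
qed

lemma locally_lipschitz_borel_measurable:
  assumes "locally_lipschitz u"
  shows "u \<in> borel_measurable borel"
  using locally_lipschitz_imp_continuous_on[OF assms] by (rule borel_measurable_continuous_onI)

lemma locally_lipschitz_imp_locally_Lp: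
  assumes "locally_lipschitz u"
  shows "locally_Lp k UNIV u"
proof (rule locally_Lp_if_AE_locally_bounded)
  show "u \<in> borel_measurable lebesgue"
    using locally_lipschitz_borel_measurable[OF assms] by (simp add: measurable_completion)
  show "\<exists>B\<ge>0. AE x in lebesgue. norm x \<le> R \<longrightarrow> \<bar>u x\<bar> \<le> B" for R
    using locally_lipschitz_bounded_on_ball[OF assms, of R] by blast
qed

text \<open>All steps have length at most \<open>norm b\<close>, so both points stay in the ball of
  radius \<open>R + norm b\<close> and one Lipschitz constant serves every \<open>n\<close>.\<close>

lemma difference_quotient_bound:
  assumes "locally_lipschitz u"
  shows "\<exists>B\<ge>0. \<forall>x n. norm x \<le> R \<longrightarrow>
    \<bar>(u (x + b /\<^sub>R real (Suc n)) - u x) * real (Suc n)\<bar> \<le> B"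
proof -
  obtain L where L: "L \<ge> 0" "\<forall>x y. norm x \<le> R + norm b \<longrightarrow> norm y \<le> R + norm b \<longrightarrow>
      \<bar>u x - u y\<bar> \<le> L * norm (x - y)"
    using locally_lipschitzD[OF assms, of "R + norm b"] by blast
  show ?thesis
  proof (intro exI[of _ "L * norm b"] conjI allI impI)
    show "L * norm b \<ge> 0" using L(1) by simp
    fix x :: 'a and n assume x: "norm x \<le> R"
    have le: "norm (b /\<^sub>R real (Suc n)) \<le> norm b"
      by (simp add: field_simps)
    have "\<bar>u (x + b /\<^sub>R real (Suc n)) - u x\<bar> \<le> L * norm ((x + b /\<^sub>R real (Suc n)) - x)"
    proof (rule L(2)[rule_format])
      show "norm (x + b /\<^sub>R real (Suc n)) \<le> R + norm b"
        using norm_triangle_ineq[of x "b /\<^sub>R real (Suc n)"] le x by linarith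
      show "norm x \<le> R + norm b" using x norm_ge_zero[of b] by linarith
    qed
    then have "\<bar>u (x + b /\<^sub>R real (Suc n)) - u x\<bar> * real (Suc n)
        \<le> (L * norm (b /\<^sub>R real (Suc n))) * real (Suc n)"
      by (intro mult_right_mono) auto
    also have "\<dots> = L * norm b" by simp
    finally show "\<bar>(u (x + b /\<^sub>R real (Suc n)) - u x) * real (Suc n)\<bar> \<le> L * norm b"
      by (simp add: abs_mult)
  qed
qed

lemma directional_derivative_borel_measurable:
  assumes "locally_lipschitz u"
  shows "directional_derivative u b \<in> borel_measurable borel"
proof -
  note locally_lipschitz_borel_measurable[OF assms, measurable]
  show ?thesis unfolding directional_derivative_def by measurable
qed

lemma directional_derivative_locally_Lp:
  assumes u: "locally_lipschitz u"
    and lim: "AE x in lebesgue. (\<lambda>n. (u (x + b /\<^sub>R real (Suc n)) - u x) * real (Suc n))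
      \<longlonglongrightarrow> directional_derivative u b x"
  shows "locally_Lp k UNIV (directional_derivative u b)"
proof (rule locally_Lp_if_AE_locally_bounded)
  show "directional_derivative u b \<in> borel_measurable lebesgue"
    using directional_derivative_borel_measurable[OF u] by (simp add: measurable_completion)
  fix R
  obtain B where B: "B \<ge> 0"
    "\<forall>x n. norm x \<le> R \<longrightarrow> \<bar>(u (x + b /\<^sub>R real (Suc n)) - u x) * real (Suc n)\<bar> \<le> B"
    using difference_quotient_bound[OF u, of R b] by blast
  have "AE x in lebesgue. norm x \<le> R \<longrightarrow> \<bar>directional_derivative u b x\<bar> \<le> B"
    using lim
  proof eventually_elim
    case (elim x)
    show ?case
      using LIMSEQ_le_const2[OF tendsto_rabs[OF elim]] B(2) by blast
  qed
  with B(1) show "\<exists>B\<ge>0. AE x in lebesgue. norm x \<le> R \<longrightarrow> \<bar>directional_derivative u b x\<bar> \<le> B"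
    by blast
qed

section \<open>Test functions and integration by parts for difference quotients\<close>

lemma test_function_C1:
  assumes "test_function UNIV \<phi>" "b \<in> Basis"
  obtains \<phi>' R where "\<And>x. (\<phi> has_derivative \<phi>' x) (at x)" "continuous_on UNIV (\<lambda>x. \<phi>' x b)"
    "\<And>x. norm x > R \<Longrightarrow> \<phi> x = 0" "\<And>x. norm x > R \<Longrightarrow> \<phi>' x b = 0" "R \<ge> 0"
proof -
  have "differentiable_times (Suc 0) \<phi>"
    using assms(1) unfolding test_function_def smooth_def by blast
  then obtain \<phi>' where d: "\<And>x. (\<phi> has_derivative \<phi>' x) (at x)" "continuous_on UNIV (\<lambda>x. \<phi>' x b)"
    using assms(2) by auto
  have "bounded (closure {x. \<phi> x \<noteq> 0})"
    using assms(1) unfolding test_function_def by (blast intro: compact_imp_bounded)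
  then obtain R where R: "\<forall>x\<in>closure {x. \<phi> x \<noteq> 0}. norm x \<le> R"
    by (auto simp: bounded_iff)
  have R0: "\<phi> x = 0" if "norm x > \<bar>R\<bar>" for x
  proof (rule ccontr)
    assume "\<phi> x \<noteq> 0"
    then have "x \<in> closure {x. \<phi> x \<noteq> 0}"
      using closure_subset[of "{x. \<phi> x \<noteq> 0}"] by auto
    with R have "norm x \<le> R" by blast
    with that show False by simp
  qed
  have "\<phi>' x b = 0" if "norm x > \<bar>R\<bar>" for x
  proof -
    have ev: "\<forall>\<^sub>F y in nhds x. \<phi> y = 0"
    proof (rule eventually_nhds_in_open[of "{y. norm y > \<bar>R\<bar>}", THEN eventually_mono])
      show "open {y::'a. \<bar>R\<bar> < norm y}"
        by (intro open_Collect_less continuous_intros)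
    qed (use that R0 in auto)
    have "((\<lambda>y. 0) has_derivative \<phi>' x) (at x)"
      by (rule has_derivative_transform_eventually[OF d(1)])
        (use ev R0[OF that] in \<open>auto simp: eventually_nhds_conv_at\<close>)
    then have "\<phi>' x = (\<lambda>_. 0)"
      using has_derivative_unique has_derivative_const by blast
    then show ?thesis by simp
  qed
  with d R0 show ?thesis using that[of \<phi>' "\<bar>R\<bar>"] by auto
qed

text \<open>Mean value estimate on the segment from \<open>x\<close> to
  \<open>x - b / (n + 1)\<close>. The step goes backwards because this is the quotient that reaches
  the test function after the translation.\<close>

lemma test_function_difference_quotient_bound:
  fixes \<phi> :: "'a::euclidean_space \<Rightarrow> real"
  assumes d: "\<And>x. (\<phi> has_derivative \<phi>' x) (at x)"
    and M: "\<And>x. \<bar>\<phi>' x b\<bar> \<le> M"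
  shows "\<bar>(\<phi> (x + (- b) /\<^sub>R real (Suc n)) - \<phi> x) * real (Suc n)\<bar> \<le> M"
proof -
  let ?g = "\<lambda>s. \<phi> (x + s *\<^sub>R (- b))"
  have dg: "(?g has_derivative (\<lambda>s. s * (- \<phi>' (x + r *\<^sub>R (- b)) b))) (at r within S)" for r S
  proof -
    interpret bounded_linear "\<phi>' (x + r *\<^sub>R (- b))" using d by (rule has_derivative_bounded_linear)
    have "(?g has_derivative (\<lambda>s. \<phi>' (x + r *\<^sub>R (- b)) (s *\<^sub>R (- b)))) (at r within S)"
    proof (rule has_derivative_compose[of "\<lambda>s. x + s *\<^sub>R (- b)" "\<lambda>s. s *\<^sub>R (- b)" r S \<phi>])
      show "((\<lambda>s. x + s *\<^sub>R - b) has_derivative (\<lambda>s. s *\<^sub>R - b)) (at r within S)"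
        by (auto intro!: derivative_eq_intros)
    qed (use d in simp)
    moreover have "\<phi>' (x + r *\<^sub>R (- b)) (s *\<^sub>R (- b)) = s * (- \<phi>' (x + r *\<^sub>R (- b)) b)" for s
      by (subst scaleR, subst neg) simp
    ultimately show ?thesis by simp
  qed
  have "norm (?g (1 / real (Suc n)) - ?g 0) \<le> M * norm (1 / real (Suc n) - 0)"
  proof (rule differentiable_bound[of "{0..1 / real (Suc n)}" ?g "\<lambda>r s. s * (- \<phi>' (x + r *\<^sub>R (- b)) b)"])
    show "onorm (\<lambda>s. s * - \<phi>' (x + r *\<^sub>R - b) b) \<le> M" for r
      by (rule onorm_le) (use mult_left_mono[OF M abs_ge_zero] in \<open>simp add: abs_mult mult.commute\<close>)
  qed (use dg in auto)
  then have "\<bar>?g (1 / real (Suc n)) - ?g 0\<bar> * real (Suc n) \<le> M"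
    by (simp add: field_simps)
  then show ?thesis by (simp add: abs_mult divide_inverse)
qed

lemma integrable_lebesgue_continuous_compact_support:
  fixes f :: "'a::euclidean_space \<Rightarrow> real"
  assumes "continuous_on UNIV f" and "\<And>x. norm x > R \<Longrightarrow> f x = 0"
  shows "integrable lebesgue f"
proof -
  have "integrable lborel (\<lambda>x. indicator (cball 0 R) x *\<^sub>R f x)"
    using assms(1) by (intro borel_integrable_compact) (auto intro: continuous_on_subset)
  also have "(\<lambda>x. indicator (cball 0 R) x *\<^sub>R f x) = f"
    using assms(2) by (auto simp: indicator_def fun_eq_iff)
  finally show ?thesis
    using borel_measurable_continuous_onI[OF assms(1)] by (simp add: integrable_completion)
qed

text \<open>
  Translation invariance moves the difference quotient from \<open>u\<close> to the test function;
  dominated convergence then gives the weak derivative.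
\<close>
lemma weak_partial_directional_derivative:
  fixes u :: "'a::euclidean_space \<Rightarrow> real"
  assumes u: "locally_lipschitz u" and b: "b \<in> Basis"
    and lim: "AE x in lebesgue. (\<lambda>n. (u (x + b /\<^sub>R real (Suc n)) - u x) * real (Suc n))
      \<longlonglongrightarrow> directional_derivative u b x"
  shows "weak_partial UNIV b u (directional_derivative u b)"
  unfolding weak_partial_def
proof (intro conjI allI impI)
  show "locally_Lp 1 UNIV u" using u by (rule locally_lipschitz_imp_locally_Lp)
  show "locally_Lp 1 UNIV (directional_derivative u b)"
    using u lim by (rule directional_derivative_locally_Lp)
  fix \<phi> :: "'a \<Rightarrow> real" assume "test_function UNIV \<phi>"
  then obtain \<phi>' R where d: "\<And>x. (\<phi> has_derivative \<phi>' x) (at x)"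
    and cont': "continuous_on UNIV (\<lambda>x. \<phi>' x b)"
    and R: "\<And>x. norm x > R \<Longrightarrow> \<phi> x = 0" "\<And>x. norm x > R \<Longrightarrow> \<phi>' x b = 0" "R \<ge> 0"
    by (rule test_function_C1[OF _ b]) metis
  have fd: "frechet_derivative \<phi> (at x) = \<phi>' x" for x
    using frechet_derivative_at[OF d] by metis
  have cont: "continuous_on UNIV \<phi>"
    using d by (meson continuous_at_imp_continuous_on has_derivative_continuous)
  have contu: "continuous_on UNIV u"
    using u by (rule locally_lipschitz_imp_continuous_on)
  have bmu [measurable]: "u \<in> borel_measurable borel"
    and bm [measurable]: "\<phi> \<in> borel_measurable borel"
    and bm' [measurable]: "(\<lambda>x. \<phi>' x b) \<in> borel_measurable borel"
    using contu cont cont' by (auto intro: borel_measurable_continuous_onI)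
  note bmd [measurable] = directional_derivative_borel_measurable[OF u, of b]
  let ?h = "\<lambda>n. b /\<^sub>R real (Suc n)"
  let ?R = "R + norm b"
  have hle: "norm (?h n) \<le> norm b" for n by (simp add: field_simps)
  \<comment> \<open>Enlarging the radius by \<open>norm b\<close> keeps the shifted supports in one
    ball, which carries all dominating functions.\<close>
  have out: "norm (x + ?h n) > R" "norm (x + (- b) /\<^sub>R real (Suc n)) > R" "norm x > R"
    if "norm x > ?R" for x n
  proof -
    have "norm x \<le> norm (x + ?h n) + norm (?h n)"
      using norm_triangle_ineq4[of "x + ?h n" "?h n"] by simp
    then show "norm (x + ?h n) > R" using hle[of n] that by linarith
    have "norm x \<le> norm (x + (- b) /\<^sub>R real (Suc n)) + norm (?h n)"
      using norm_triangle_ineq[of "x + (- b) /\<^sub>R real (Suc n)" "?h n"] by simp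
    then show "norm (x + (- b) /\<^sub>R real (Suc n)) > R" using hle[of n] that by linarith
    show "norm x > R" using that norm_ge_zero[of b] by linarith
  qed

  have bnd: "\<exists>B\<ge>0. \<forall>x. \<bar>f x\<bar> \<le> B"
    if c: "continuous_on UNIV f" and z: "\<And>x. norm x > R \<Longrightarrow> f x = 0" for f :: "'a \<Rightarrow> real"
  proof -
    have "bounded (f ` cball 0 R)"
      using c by (intro compact_imp_bounded compact_continuous_image) (auto intro: continuous_on_subset)
    then obtain B where B: "\<forall>x\<in>cball 0 R. \<bar>f x\<bar> \<le> B" by (auto simp: bounded_iff)
    have "\<bar>f x\<bar> \<le> \<bar>B\<bar>" for x
    proof (cases "norm x \<le> R")
      case True
      then have "\<bar>f x\<bar> \<le> B" using B by simp
      then show ?thesis by linarith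
    qed (use z in simp)
    then show ?thesis by (intro exI[of _ "\<bar>B\<bar>"]) auto
  qed
  obtain M where M: "M \<ge> 0" "\<forall>x. \<bar>\<phi> x\<bar> \<le> M" using bnd[OF cont R(1)] by blast
  obtain M' where M': "M' \<ge> 0" "\<forall>x. \<bar>\<phi>' x b\<bar> \<le> M'" using bnd[OF cont' R(2)] by blast
  obtain U where U: "U \<ge> 0" "\<forall>x. norm x \<le> ?R \<longrightarrow> \<bar>u x\<bar> \<le> U"
    using locally_lipschitz_bounded_on_ball[OF u] by blast
  obtain L where L: "L \<ge> 0" "\<forall>x n. norm x \<le> ?R \<longrightarrow>
      \<bar>(u (x + b /\<^sub>R real (Suc n)) - u x) * real (Suc n)\<bar> \<le> L"
    using difference_quotient_bound[OF u] by blast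
  have wint: "integrable lebesgue (\<lambda>x::'a. C * indicator (cball 0 ?R) x)" for C :: real
    by (rule integrable_lebesgue_if_bounded_on_cball[where B="\<bar>C\<bar>" and R="?R"])
      (auto simp: indicator_def intro!: measurable_completion)

  have lim1: "(\<lambda>n. LINT x|lebesgue. (u (x + ?h n) - u x) * real (Suc n) * \<phi> x)
      \<longlonglongrightarrow> (LINT x|lebesgue. directional_derivative u b x * \<phi> x)"
  proof (rule integral_dominated_convergence[where w="\<lambda>x. L * M * indicator (cball 0 ?R) x"])
    show "(\<lambda>x. directional_derivative u b x * \<phi> x) \<in> borel_measurable lebesgue"
      by (intro measurable_completion) simp
    show "(\<lambda>x. (u (x + ?h n) - u x) * real (Suc n) * \<phi> x) \<in> borel_measurable lebesgue" for n
      by (intro measurable_completion) simp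
    show "AE x in lebesgue. (\<lambda>n. (u (x + ?h n) - u x) * real (Suc n) * \<phi> x)
        \<longlonglongrightarrow> directional_derivative u b x * \<phi> x"
      using lim by eventually_elim (intro tendsto_mult tendsto_const)
    show "AE x in lebesgue. norm ((u (x + ?h n) - u x) * real (Suc n) * \<phi> x)
        \<le> L * M * indicator (cball 0 ?R) x" for n
    proof (rule AE_I2)
      fix x
      show "norm ((u (x + ?h n) - u x) * real (Suc n) * \<phi> x) \<le> L * M * indicator (cball 0 ?R) x"
      proof (cases "norm x \<le> ?R")
        case True
        have "\<bar>(u (x + ?h n) - u x) * real (Suc n)\<bar> * \<bar>\<phi> x\<bar> \<le> L * M"
          using L M True by (intro mult_mono) auto
        then show ?thesis using True by (simp add: abs_mult)
      next
        case False
        then show ?thesis using R(1)[of x] out(3)[of x] by (simp add: indicator_def)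
      qed
    qed
  qed (rule wint)

  have lim2: "(\<lambda>n. LINT x|lebesgue. u x * ((\<phi> (x + (- b) /\<^sub>R real (Suc n)) - \<phi> x) * real (Suc n)))
      \<longlonglongrightarrow> (LINT x|lebesgue. u x * \<phi>' x (- b))"
  proof (rule integral_dominated_convergence[where w="\<lambda>x. U * M' * indicator (cball 0 ?R) x"])
    have neg: "\<phi>' x (- b) = - \<phi>' x b" for x
      using has_derivative_bounded_linear[OF d, THEN bounded_linear.linear] by (rule linear_neg)
    show "(\<lambda>x. u x * \<phi>' x (- b)) \<in> borel_measurable lebesgue"
      unfolding neg by (intro measurable_completion) simp
    show "(\<lambda>x. u x * ((\<phi> (x + (- b) /\<^sub>R real (Suc n)) - \<phi> x) * real (Suc n))) \<in> borel_measurable lebesgue" for n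
      by (intro measurable_completion) simp
    show "AE x in lebesgue. (\<lambda>n. u x * ((\<phi> (x + (- b) /\<^sub>R real (Suc n)) - \<phi> x) * real (Suc n)))
        \<longlonglongrightarrow> u x * \<phi>' x (- b)"
      by (intro AE_I2 tendsto_mult tendsto_const difference_quotient_tendsto d)
    show "AE x in lebesgue. norm (u x * ((\<phi> (x + (- b) /\<^sub>R real (Suc n)) - \<phi> x) * real (Suc n)))
        \<le> U * M' * indicator (cball 0 ?R) x" for n
    proof (rule AE_I2)
      fix x
      show "norm (u x * ((\<phi> (x + (- b) /\<^sub>R real (Suc n)) - \<phi> x) * real (Suc n)))
        \<le> U * M' * indicator (cball 0 ?R) x"
      proof (cases "norm x \<le> ?R")
        case True
        have "\<bar>u x\<bar> * \<bar>(\<phi> (x + (- b) /\<^sub>R real (Suc n)) - \<phi> x) * real (Suc n)\<bar> \<le> U * M'"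
          using U True M' test_function_difference_quotient_bound[OF d, of b M' x n]
          by (intro mult_mono) auto
        then show ?thesis using True by (simp add: abs_mult)
      next
        case False
        then have "\<phi> (x + (- b) /\<^sub>R real (Suc n)) = 0" "\<phi> x = 0"
          using R(1) out(2,3) by auto
        then show ?thesis using False by (simp add: indicator_def)
      qed
    qed
  qed (rule wint)

  have eq: "(LINT x|lebesgue. (u (x + ?h n) - u x) * real (Suc n) * \<phi> x)
      = (LINT x|lebesgue. u x * ((\<phi> (x + (- b) /\<^sub>R real (Suc n)) - \<phi> x) * real (Suc n)))" for n
  proof -
    let ?g = "\<lambda>x. real (Suc n) * (u x * \<phi> (x + (- b) /\<^sub>R real (Suc n)))"
    let ?k = "\<lambda>x. real (Suc n) * (u x * \<phi> x)"
    have cg: "continuous_on UNIV (\<lambda>x. \<phi> (x + c))" "continuous_on UNIV (\<lambda>x. u (x + c))" for c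
      using continuous_on_compose2[OF cont, of UNIV "\<lambda>x. x + c"]
        continuous_on_compose2[OF contu, of UNIV "\<lambda>x. x + c"]
      by (simp_all add: continuous_on_add continuous_on_id continuous_on_const)
    have i1: "integrable lebesgue (\<lambda>x. ?g (x + ?h n))"
    proof (rule integrable_lebesgue_continuous_compact_support)
      show "continuous_on UNIV (\<lambda>x. ?g (x + ?h n))"
        using cont cg(2)[of "?h n"] by (auto intro!: continuous_intros)
    qed (use R(1) in auto)
    have i2: "integrable lebesgue ?k"
      by (rule integrable_lebesgue_continuous_compact_support[where R=R])
        (use contu cont R(1) in \<open>auto intro!: continuous_intros\<close>)
    have i3: "integrable lebesgue ?g"
    proof (rule integrable_lebesgue_continuous_compact_support)
      show "continuous_on UNIV ?g"
        using contu cg(1)[of "(- b) /\<^sub>R real (Suc n)"] by (auto intro!: continuous_intros)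
      show "?g x = 0" if "norm x > ?R" for x using R(1) out(2)[OF that, of n] by simp
    qed
    have "(LINT x|lebesgue. (u (x + ?h n) - u x) * real (Suc n) * \<phi> x)
        = (LINT x|lebesgue. ?g (x + ?h n) - ?k x)"
      by (rule Bochner_Integration.integral_cong) (simp_all add: algebra_simps)
    also have "\<dots> = (LINT x|lebesgue. ?g (x + ?h n)) - (LINT x|lebesgue. ?k x)"
      using i1 i2 by (rule Bochner_Integration.integral_diff)
    also have "(LINT x|lebesgue. ?g (x + ?h n)) = (LINT x|lebesgue. ?g x)"
      by (rule integral_lebesgue_translation) measurable
    also have "(LINT x|lebesgue. ?g x) - (LINT x|lebesgue. ?k x) = (LINT x|lebesgue. ?g x - ?k x)"
      using i3 i2 by (rule Bochner_Integration.integral_diff[symmetric])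
    also have "\<dots> = (LINT x|lebesgue. u x * ((\<phi> (x + (- b) /\<^sub>R real (Suc n)) - \<phi> x) * real (Suc n)))"
      by (rule Bochner_Integration.integral_cong) (simp_all add: algebra_simps)
    finally show ?thesis .
  qed
  have "(LINT x|lebesgue. directional_derivative u b x * \<phi> x) = (LINT x|lebesgue. u x * \<phi>' x (- b))"
    using lim1 lim2 unfolding eq by (rule LIMSEQ_unique)
  also have "\<dots> = - (LINT x|lebesgue. u x * \<phi>' x b)"
    using has_derivative_bounded_linear[OF d, THEN bounded_linear.linear]
    by (simp add: linear_neg)
  finally show "(LINT x:UNIV|lebesgue. u x * frechet_derivative \<phi> (at x) b)
      = - (LINT x:UNIV|lebesgue. directional_derivative u b x * \<phi> x)"
    by (simp add: set_lebesgue_integral_def fd)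
qed

section \<open>Closure properties of the locally Lipschitz functions\<close>

lemma locally_lipschitz_const: "locally_lipschitz (\<lambda>_. c)"
  unfolding locally_lipschitz_def by (auto intro!: exI[of _ 0])

lemma locally_lipschitz_nth: "locally_lipschitz (\<lambda>p::real^'n. p $ i)"
  unfolding locally_lipschitz_def
proof (intro allI exI ballI)
  show "\<bar>x $ i - y $ i\<bar> \<le> 1 * norm (x - y)" for x y :: "real^'n"
    using component_le_norm_cart[of "x - y" i] by simp
qed

lemma locally_lipschitz_add:
  assumes "locally_lipschitz f" "locally_lipschitz g"
  shows "locally_lipschitz (\<lambda>p. f p + g p)"
  unfolding locally_lipschitz_def
proof (rule allI)
  fix R
  obtain L M where "\<forall>x y. norm x \<le> R \<longrightarrow> norm y \<le> R \<longrightarrow> \<bar>f x - f y\<bar> \<le> L * norm (x - y)"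
    "\<forall>x y. norm x \<le> R \<longrightarrow> norm y \<le> R \<longrightarrow> \<bar>g x - g y\<bar> \<le> M * norm (x - y)"
    using assms[THEN locally_lipschitzD, of R] by blast
  then have "\<bar>(f x + g x) - (f y + g y)\<bar> \<le> (L + M) * norm (x - y)"
    if "norm x \<le> R" "norm y \<le> R" for x y
    using that abs_triangle_ineq[of "f x - f y" "g x - g y"]
    by (smt (verit, best) distrib_right)
  then show "\<exists>L. \<forall>x\<in>cball 0 R. \<forall>y\<in>cball 0 R. \<bar>(f x + g x) - (f y + g y)\<bar> \<le> L * norm (x - y)"
    by (intro exI[of _ "L + M"]) simp
qed

lemma locally_lipschitz_mult:
  assumes "locally_lipschitz f" "locally_lipschitz g"
  shows "locally_lipschitz (\<lambda>p. f p * g p)"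
  unfolding locally_lipschitz_def
proof (rule allI)
  fix R
  obtain L M where L: "L \<ge> 0" "\<forall>x y. norm x \<le> R \<longrightarrow> norm y \<le> R \<longrightarrow> \<bar>f x - f y\<bar> \<le> L * norm (x - y)"
    and M: "M \<ge> 0" "\<forall>x y. norm x \<le> R \<longrightarrow> norm y \<le> R \<longrightarrow> \<bar>g x - g y\<bar> \<le> M * norm (x - y)"
    using assms[THEN locally_lipschitzD, of R] by blast
  obtain B C where B: "B \<ge> 0" "\<forall>x. norm x \<le> R \<longrightarrow> \<bar>f x\<bar> \<le> B"
    and C: "C \<ge> 0" "\<forall>x. norm x \<le> R \<longrightarrow> \<bar>g x\<bar> \<le> C"
    using assms[THEN locally_lipschitz_bounded_on_ball, of R] by blast
  have "\<bar>f x * g x - f y * g y\<bar> \<le> (B * M + L * C) * norm (x - y)"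
    if "norm x \<le> R" "norm y \<le> R" for x y
  proof -
    have "\<bar>f x * g x - f y * g y\<bar> = \<bar>f x * (g x - g y) + (f x - f y) * g y\<bar>"
      by (simp add: algebra_simps)
    also have "\<dots> \<le> \<bar>f x\<bar> * \<bar>g x - g y\<bar> + \<bar>f x - f y\<bar> * \<bar>g y\<bar>"
      by (metis abs_mult abs_triangle_ineq)
    also have "\<dots> \<le> B * (M * norm (x - y)) + (L * norm (x - y)) * C"
      using B C L M that by (intro add_mono mult_mono) auto
    finally show ?thesis by (simp add: algebra_simps)
  qed
  then show "\<exists>L. \<forall>x\<in>cball 0 R. \<forall>y\<in>cball 0 R. \<bar>f x * g x - f y * g y\<bar> \<le> L * norm (x - y)"
    by (intro exI[of _ "B * M + L * C"]) simp
qed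

lemma locally_lipschitz_compose:
  assumes f: "locally_lipschitz f" and h: "\<And>B. \<exists>L\<ge>0. \<forall>r s. \<bar>r\<bar> \<le> B \<longrightarrow> \<bar>s\<bar> \<le> B \<longrightarrow> \<bar>h r - h s\<bar> \<le> L * \<bar>r - s :: real\<bar>"
  shows "locally_lipschitz (\<lambda>p. h (f p))"
  unfolding locally_lipschitz_def
proof (rule allI)
  fix R
  obtain L where L: "\<forall>x y. norm x \<le> R \<longrightarrow> norm y \<le> R \<longrightarrow> \<bar>f x - f y\<bar> \<le> L * norm (x - y)"
    using locally_lipschitzD[OF f, of R] by blast
  obtain B where B: "\<forall>x. norm x \<le> R \<longrightarrow> \<bar>f x\<bar> \<le> B"
    using locally_lipschitz_bounded_on_ball[OF f, of R] by blast
  obtain M where M: "M \<ge> 0" "\<forall>r s. \<bar>r\<bar> \<le> B \<longrightarrow> \<bar>s\<bar> \<le> B \<longrightarrow> \<bar>h r - h s\<bar> \<le> M * \<bar>r - s\<bar>"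
    using h by blast
  have "\<bar>h (f x) - h (f y)\<bar> \<le> (M * L) * norm (x - y)" if "norm x \<le> R" "norm y \<le> R" for x y
  proof -
    have "\<bar>h (f x) - h (f y)\<bar> \<le> M * \<bar>f x - f y\<bar>" using M(2) B that by blast
    also have "\<dots> \<le> M * (L * norm (x - y))" using L M(1) that by (intro mult_left_mono) auto
    finally show ?thesis by simp
  qed
  then show "\<exists>L. \<forall>x\<in>cball 0 R. \<forall>y\<in>cball 0 R. \<bar>h (f x) - h (f y)\<bar> \<le> L * norm (x - y)"
    by (intro exI[of _ "M * L"]) simp
qed

lemma locally_lipschitz_compose_1:
  assumes f: "locally_lipschitz f" and h: "\<And>r s. \<bar>h r - h s\<bar> \<le> \<bar>r - s :: real\<bar>"
  shows "locally_lipschitz (\<lambda>p. h (f p))"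
  using f by (rule locally_lipschitz_compose) (use h in \<open>auto intro!: exI[of _ 1]\<close>)

lemma locally_lipschitz_abs:
  "locally_lipschitz f \<Longrightarrow> locally_lipschitz (\<lambda>p. \<bar>f p\<bar>)"
  by (rule locally_lipschitz_compose_1) auto

lemma locally_lipschitz_uminus:
  "locally_lipschitz f \<Longrightarrow> locally_lipschitz (\<lambda>p. - f p)"
  by (rule locally_lipschitz_compose_1) auto

lemma locally_lipschitz_diff:
  "locally_lipschitz f \<Longrightarrow> locally_lipschitz g \<Longrightarrow> locally_lipschitz (\<lambda>p. f p - g p)"
  using locally_lipschitz_add[OF _ locally_lipschitz_uminus] by fastforce

lemma locally_lipschitz_max:
  assumes "locally_lipschitz f" "locally_lipschitz g"
  shows "locally_lipschitz (\<lambda>p. max (f p) (g p))"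
proof -
  have "locally_lipschitz (\<lambda>p. (f p + g p + \<bar>f p - g p\<bar>) * (1/2))"
    using assms by (intro locally_lipschitz_mult locally_lipschitz_add locally_lipschitz_abs
        locally_lipschitz_diff locally_lipschitz_const)
  also have "(\<lambda>p. (f p + g p + \<bar>f p - g p\<bar>) * (1/2)) = (\<lambda>p. max (f p) (g p))"
    by (auto simp: fun_eq_iff max_def)
  finally show ?thesis .
qed

lemma locally_lipschitz_min:
  assumes "locally_lipschitz f" "locally_lipschitz g"
  shows "locally_lipschitz (\<lambda>p. min (f p) (g p))"
proof -
  have "locally_lipschitz (\<lambda>p. - max (- f p) (- g p))"
    using assms by (intro locally_lipschitz_uminus locally_lipschitz_max)
  then show ?thesis by (simp add: minus_max_eq_min)
qed

text \<open>For \<open>a \<le> b\<close>, multiplying \<open>1 + (a - b) \<le> exp (a - b)\<close>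
  by \<open>exp b\<close> bounds the increment.\<close>

lemma exp_lipschitz_on_bounded: "\<exists>L\<ge>0. \<forall>r s. \<bar>r\<bar> \<le> B \<longrightarrow> \<bar>s\<bar> \<le> B \<longrightarrow> \<bar>exp r - exp s\<bar> \<le> L * \<bar>r - s :: real\<bar>"
proof (intro exI[of _ "exp B"] conjI allI impI)
  fix r s :: real assume "\<bar>r\<bar> \<le> B" "\<bar>s\<bar> \<le> B"
  then show "\<bar>exp r - exp s\<bar> \<le> exp B * \<bar>r - s\<bar>"
  proof (induction r s rule: linorder_wlog)
    case (le a b)
    have "1 + (a - b) \<le> exp (a - b)" by (rule exp_ge_add_one_self)
    then have "exp b * (1 - exp (a - b)) \<le> exp b * (b - a)"
      by (intro mult_left_mono) (linarith, simp)
    also have "\<dots> \<le> exp B * (b - a)" using le by (intro mult_right_mono) auto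
    finally show ?case using le by (simp add: algebra_simps flip: exp_add)
  qed (simp add: abs_minus_commute)
qed simp

lemma locally_lipschitz_exp:
  "locally_lipschitz f \<Longrightarrow> locally_lipschitz (\<lambda>p. exp (f p))"
  by (rule locally_lipschitz_compose[OF _ exp_lipschitz_on_bounded])

text \<open>The jump of \<open>sgn\<close> is harmless because \<open>g\<close> vanishes there: a
  segment joining points where \<open>f\<close> has opposite signs meets a zero of \<open>f\<close>,
  and the increments of \<open>g\<close> from that zero to the two ends add up to at most
  \<open>L\<close> times the length. This is what makes extension by reflection Lipschitz.\<close>

lemma locally_lipschitz_sgn_mult:
  assumes f: "locally_lipschitz f" and g: "locally_lipschitz g" and zero: "\<And>p. f p = 0 \<Longrightarrow> g p = 0"
  shows "locally_lipschitz (\<lambda>p. sgn (f p) * g p)"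
  unfolding locally_lipschitz_def
proof (rule allI)
  fix R
  obtain L where L: "L \<ge> 0" "\<forall>x y. norm x \<le> R \<longrightarrow> norm y \<le> R \<longrightarrow> \<bar>g x - g y\<bar> \<le> L * norm (x - y)"
    using locally_lipschitzD[OF g, of R] by blast
  have contf: "continuous_on UNIV f" using f by (rule locally_lipschitz_imp_continuous_on)
  have cross: "\<bar>g x\<bar> + \<bar>g y\<bar> \<le> L * norm (x - y)"
    if x: "norm x \<le> R" and y: "norm y \<le> R" and fxy: "f x \<le> 0" "0 \<le> f y" for x y
  proof -
    have "continuous_on {0..1} (\<lambda>s. f (x + s *\<^sub>R (y - x)))"
      by (rule continuous_on_compose2[OF contf]) (auto intro!: continuous_intros)
    then obtain s :: real where s: "0 \<le> s" "s \<le> 1" "f (x + s *\<^sub>R (y - x)) = 0"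
      using IVT'[of "\<lambda>s. f (x + s *\<^sub>R (y - x))" 0 0 1] fxy by auto
    let ?z = "x + s *\<^sub>R (y - x)"
    have "?z = (1 - s) *\<^sub>R x + s *\<^sub>R y" by (simp add: algebra_simps)
    moreover have "(1 - s) *\<^sub>R x + s *\<^sub>R y \<in> cball 0 R"
      using x y s by (intro convexD[OF convex_cball]) auto
    ultimately have z: "norm ?z \<le> R" by simp
    have gz: "g ?z = 0" using zero s(3) by simp
    have "\<bar>g x\<bar> \<le> L * norm (x - ?z)" using L(2)[rule_format, OF x z] gz by simp
    moreover have "\<bar>g y\<bar> \<le> L * norm (y - ?z)" using L(2)[rule_format, OF y z] gz by simp
    moreover have "norm (x - ?z) = s * norm (x - y)"
      using s(1) by (simp add: norm_minus_commute)
    moreover have "y - ?z = (1 - s) *\<^sub>R (y - x)" by (simp add: algebra_simps)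
    then have "norm (y - ?z) = (1 - s) * norm (x - y)"
      using s(2) by (metis abs_of_nonneg diff_ge_0_iff_ge norm_minus_commute norm_scaleR)
    ultimately have "\<bar>g x\<bar> + \<bar>g y\<bar> \<le> L * (s * norm (x - y)) + L * ((1 - s) * norm (x - y))"
      by simp
    then show ?thesis by (simp add: algebra_simps)
  qed
  have "\<bar>sgn (f x) * g x - sgn (f y) * g y\<bar> \<le> L * norm (x - y)"
    if x: "norm x \<le> R" and y: "norm y \<le> R" for x y
  proof -
    consider "f x \<le> 0" "0 \<le> f y" | "f y \<le> 0" "0 \<le> f x" | "sgn (f x) = sgn (f y)"
      by (cases "f x" "0::real" rule: linorder_cases; cases "f y" "0::real" rule: linorder_cases) auto
    then show ?thesis
    proof cases
      case 1
      then show ?thesis using cross[OF x y] by (auto simp: sgn_real_def)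
    next
      case 2
      then show ?thesis using cross[OF y x] by (auto simp: sgn_real_def norm_minus_commute)
    next
      case 3
      have "sgn (f x) * g x - sgn (f y) * g y = sgn (f y) * (g x - g y)"
        unfolding 3 by (simp add: algebra_simps)
      then have "\<bar>sgn (f x) * g x - sgn (f y) * g y\<bar> \<le> 1 * \<bar>g x - g y\<bar>"
        unfolding abs_mult by (metis abs_ge_zero abs_mult abs_sgn_eq mult_right_mono order_refl zero_le_one)
      then show ?thesis using L(2) x y by (metis mult_1 order_trans)
    qed
  qed
  then show "\<exists>L. \<forall>x\<in>cball 0 R. \<forall>y\<in>cball 0 R. \<bar>sgn (f x) * g x - sgn (f y) * g y\<bar> \<le> L * norm (x - y)"
    by (intro exI[of _ L]) simp
qed

text \<open>As \<open>g\<close> ignores coordinate \<open>i\<close>, the set is the image of a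
  coordinate hyperplane under a locally Lipschitz map, and such maps preserve null sets.\<close>

lemma negligible_graph:
  fixes g :: "real^'n \<Rightarrow> real"
  assumes g: "locally_lipschitz g" and indep: "\<And>p s. g (p + s *\<^sub>R axis i 1) = g p"
  shows "negligible {p. p $ i = g p}"
proof -
  let ?f = "\<lambda>p. p + g p *\<^sub>R axis i 1"
  have "negligible (?f ` {p. p $ i = 0})"
  proof (rule negligible_locally_Lipschitz_image)
    show "negligible {p::real^'n. p $ i = 0}"
      by (rule negligible_standard_hyperplane_cart)
    fix x :: "real^'n"
    obtain L where L: "L \<ge> 0" "\<forall>p q. norm p \<le> norm x + 1 \<longrightarrow> norm q \<le> norm x + 1 \<longrightarrow> \<bar>g p - g q\<bar> \<le> L * norm (p - q)"
      using locally_lipschitzD[OF g, of "norm x + 1"] by blast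
    have "norm (?f y - ?f x) \<le> (1 + L) * norm (y - x)" if "y \<in> ball x 1" for y
    proof -
      have "norm y \<le> norm x + 1"
        using that norm_triangle_sub[of y x] by (simp add: dist_norm norm_minus_commute)
      then have "\<bar>g y - g x\<bar> \<le> L * norm (y - x)" using L(2) by simp
      moreover have "?f y - ?f x = (y - x) + (g y - g x) *\<^sub>R axis i 1" by (simp add: algebra_simps)
      moreover have "norm ((y - x) + (g y - g x) *\<^sub>R axis i 1 :: real^'n) \<le> norm (y - x) + \<bar>g y - g x\<bar>"
        using norm_triangle_ineq[of "y - x" "(g y - g x) *\<^sub>R axis i 1"] by (simp add: norm_axis_1)
      ultimately show ?thesis by (simp add: algebra_simps)
    qed
    then show "\<exists>T B. open T \<and> x \<in> T \<and> (\<forall>y\<in>{p. p $ i = 0} \<inter> T. norm (?f y - ?f x) \<le> B * norm (y - x))"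
      by (intro exI[of _ "ball x 1"] exI[of _ "1 + L"]) auto
  qed simp
  moreover have "{p. p $ i = g p} \<subseteq> ?f ` {p. p $ i = 0}"
  proof
    fix p assume "p \<in> {p. p $ i = g p}"
    then have p: "p $ i = g p" by simp
    let ?q = "p + (- g p) *\<^sub>R axis i 1"
    have "p = ?f ?q" unfolding indep by simp
    moreover have "?q $ i = 0" using p by (simp add: axis_def)
    ultimately show "p \<in> ?f ` {p. p $ i = 0}" by blast
  qed
  ultimately show ?thesis by (rule negligible_subset)
qed

section \<open>Folding the plane\<close>

text \<open>A piecewise linear sine of period 4, with peak 1 at the point 1 and zeros at the even
  integers. Written through a distance it is 1-Lipschitz at once.\<close>

definition triangle_wave :: "real \<Rightarrow> real" where
  "triangle_wave x = 1 - infdist (x - 1) (range (\<lambda>k::int. 4 * real_of_int k))"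

lemma triangle_wave_lipschitz: "\<bar>triangle_wave x - triangle_wave y\<bar> \<le> \<bar>x - y\<bar>"
proof -
  have "\<bar>infdist (x - 1) A - infdist (y - 1) A\<bar> \<le> \<bar>x - y\<bar>" for A
    using infdist_triangle_abs[of "x - 1" A "y - 1"] by (simp add: dist_real_def)
  then show ?thesis unfolding triangle_wave_def by (smt (verit))
qed

text \<open>A distance of at most 2, half the period, makes \<open>4 * k\<close> a nearest point of
  the lattice.\<close>

lemma triangle_wave_eq:
  assumes "\<bar>x - 1 - 4 * real_of_int k\<bar> \<le> 2"
  shows "triangle_wave x = 1 - \<bar>x - 1 - 4 * real_of_int k\<bar>"
proof -
  let ?A = "range (\<lambda>k::int. 4 * real_of_int k)"
  have "infdist (x - 1) ?A \<le> \<bar>x - 1 - 4 * real_of_int k\<bar>"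
    using infdist_le[of "4 * real_of_int k" ?A "x - 1"] by (auto simp: dist_real_def)
  moreover have "\<bar>x - 1 - 4 * real_of_int k\<bar> \<le> infdist (x - 1) ?A"
  proof -
    have "\<bar>x - 1 - 4 * real_of_int k\<bar> \<le> dist (x - 1) (4 * real_of_int m)" for m
    proof (cases "m = k")
      case False
      then have "m \<le> k - 1 \<or> m \<ge> k + 1" by linarith
      then have "real_of_int m \<le> real_of_int k - 1 \<or> real_of_int m \<ge> real_of_int k + 1"
        by linarith
      then show ?thesis using assms unfolding dist_real_def by linarith
    qed (simp add: dist_real_def)
    then show ?thesis
      by (subst infdist_notempty) (auto intro!: cINF_greatest)
  qed
  ultimately show ?thesis unfolding triangle_wave_def by simp
qed

text \<open>The number \<open>(-1) ^ m\<close> for an integer \<open>m\<close>, which is the slope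
  of the wave at \<open>2 * m\<close>.\<close>

definition alt_sign :: "int \<Rightarrow> real" where
  "alt_sign m = (if even m then 1 else -1)"

lemma alt_sign_cases: "alt_sign m = 1 \<or> alt_sign m = -1"
  by (simp add: alt_sign_def)

lemma triangle_wave_shift:
  assumes "\<bar>\<xi>\<bar> \<le> 1"
  shows "triangle_wave (2 * real_of_int m + \<xi>) = alt_sign m * \<xi>"
    and "triangle_wave (2 * real_of_int m + \<xi> + 1) = alt_sign m * (1 - \<bar>\<xi>\<bar>)"
proof -
  show "triangle_wave (2 * real_of_int m + \<xi>) = alt_sign m * \<xi>"
  proof (cases "even m")
    case True
    then obtain k where "m = 2 * k" by (elim evenE)
    then show ?thesis using assms triangle_wave_eq[of "2 * real_of_int m + \<xi>" k]
      by (simp add: alt_sign_def)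
  next
    case False
    then obtain k where "m = 2 * k + 1" by (elim oddE)
    then show ?thesis using assms triangle_wave_eq[of "2 * real_of_int m + \<xi>" k]
      by (simp add: alt_sign_def)
  qed
  show "triangle_wave (2 * real_of_int m + \<xi> + 1) = alt_sign m * (1 - \<bar>\<xi>\<bar>)"
  proof (cases "even m")
    case True
    then obtain k where "m = 2 * k" by (elim evenE)
    then show ?thesis using assms triangle_wave_eq[of "2 * real_of_int m + \<xi> + 1" k]
      by (simp add: alt_sign_def)
  next
    case False
    then obtain k where k: "m = 2 * k + 1" by (elim oddE)
    \<comment> \<open>The argument minus 1 is \<open>4 * k + 2 + \<xi>\<close>, so the sign of
      \<open>\<xi>\<close> decides whether \<open>4 * k\<close> or \<open>4 * (k + 1)\<close> is
      nearest.\<close>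
    show ?thesis
    proof (cases "\<xi> \<ge> 0")
      case True
      then show ?thesis using assms k triangle_wave_eq[of "2 * real_of_int m + \<xi> + 1" "k + 1"]
        by (simp add: alt_sign_def)
    next
      case False
      then show ?thesis using assms k triangle_wave_eq[of "2 * real_of_int m + \<xi> + 1" k]
        by (simp add: alt_sign_def)
    qed
  qed
qed

section \<open>The folding map, cell by cell\<close>

lemma reduce_mod_2:
  obtains m :: int and \<xi> :: real where "x = 2 * real_of_int m + \<xi>" "\<bar>\<xi>\<bar> \<le> 1"
proof
  show "x = 2 * real_of_int \<lfloor>(x + 1) / 2\<rfloor> + (x - 2 * real_of_int \<lfloor>(x + 1) / 2\<rfloor>)" by simp
  show "\<bar>x - 2 * real_of_int \<lfloor>(x + 1) / 2\<rfloor>\<bar> \<le> 1"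
    using floor_correct[of "(x + 1) / 2"] by (simp add: abs_le_iff field_simps)
qed

text \<open>
  The folding of the tiling: \<open>(fold_A, fold_V)\<close> is the point of \<open>B\<close> equivalent to \<open>(x, y)\<close> under
  the reflections, and \<open>|fold_W| = min A (1 - A - |V|)\<close> is the height over it. Up to sign,
  \<open>triangle_wave\<close> at \<open>x\<close> and at \<open>x + 1\<close> plays the role of sine and cosine, with
  \<open>|triangle_wave x| + |triangle_wave (x + 1)| = 1\<close>; \<open>fold_W\<close> vanishes on the mirrors
  \<open>x \<in> 2\<int>\<close>, \<open>y \<in> 2\<int> + 1\<close>, \<open>x \<plusminus> y \<in> 2\<int> + 1\<close>.
\<close>

definition fold_A :: "real \<Rightarrow> real \<Rightarrow> real" where
  "fold_A x y = min \<bar>triangle_wave x\<bar> \<bar>triangle_wave (y + 1)\<bar>"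

text \<open>The expression \<open>(|a + b| - |a - b|) / 2\<close> is \<open>min |a| |b|\<close> with
  the sign of \<open>a * b\<close>, in a form that is visibly Lipschitz.\<close>

definition fold_V :: "real \<Rightarrow> real \<Rightarrow> real" where
  "fold_V x y = (\<bar>triangle_wave (x + 1) + triangle_wave y\<bar>
     - \<bar>triangle_wave (x + 1) - triangle_wave y\<bar>) / 2"

text \<open>The height with a sign that changes across the mirrors
  \<open>x \<plusminus> y \<in> 2\<int> + 1\<close>. The other mirrors are left to the
  \<open>sgn\<close> factors of \<open>fold_W\<close>; the clamp between \<open>- fold_A\<close> and
  \<open>fold_A\<close> makes \<open>fold_C\<close> vanish where these jump.\<close>

definition fold_C :: "real \<Rightarrow> real \<Rightarrow> real" where
  "fold_C x y = max (- fold_A x y) (min (fold_A x y) (\<bar>triangle_wave (y + 1)\<bar> - \<bar>triangle_wave x\<bar>))"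

definition fold_W :: "real \<Rightarrow> real \<Rightarrow> real" where
  "fold_W x y = sgn (triangle_wave x) * (sgn (triangle_wave (y + 1)) * fold_C x y)"

text \<open>Explicit formulas on the cell with centre \<open>(2 * m, 2 * n)\<close>, in coordinates
  reflected into its first quadrant. The signs \<open>s\<close> and \<open>r\<close> are hypotheses
  instead of values of \<open>sgn\<close>, so that either sign may be taken on an axis.\<close>

lemma fold_values:
  fixes m n :: int
  assumes "\<bar>\<xi>\<bar> \<le> 1" "\<bar>\<upsilon>\<bar> \<le> 1" "x = 2 * real_of_int m + \<xi>" "y = 2 * real_of_int n + \<upsilon>"
    and s: "s = 1 \<or> s = -1" "s * \<xi> \<ge> 0" and r: "r = 1 \<or> r = -1" "r * \<upsilon> \<ge> 0"
    and \<kappa>: "\<kappa> = alt_sign m * alt_sign n"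
  shows "fold_A x y = min (s * \<xi>) (1 - r * \<upsilon>)"
    and "fold_V x y = \<kappa> * r * min (1 - s * \<xi>) (r * \<upsilon>)"
    and "fold_W x y = \<kappa> * s * max (- min (s * \<xi>) (1 - r * \<upsilon>)) (min (min (s * \<xi>) (1 - r * \<upsilon>)) (1 - r * \<upsilon> - s * \<xi>))"
proof -
  have tx: "triangle_wave x = alt_sign m * \<xi>" "triangle_wave (x + 1) = alt_sign m * (1 - s * \<xi>)"
    using triangle_wave_shift[OF assms(1), of m] assms(3) s by auto
  have ty: "triangle_wave y = alt_sign n * \<upsilon>" "triangle_wave (y + 1) = alt_sign n * (1 - r * \<upsilon>)"
    using triangle_wave_shift[OF assms(2), of n] assms(4) r by auto
  have ax: "\<bar>triangle_wave x\<bar> = s * \<xi>" and ay: "\<bar>triangle_wave (y + 1)\<bar> = 1 - r * \<upsilon>"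
    unfolding tx ty using alt_sign_cases[of m] alt_sign_cases[of n] s r assms(1,2) by auto
  show A: "fold_A x y = min (s * \<xi>) (1 - r * \<upsilon>)"
    unfolding fold_A_def ax ay ..
  show "fold_V x y = \<kappa> * r * min (1 - s * \<xi>) (r * \<upsilon>)"
    unfolding fold_V_def tx ty \<kappa>
    using alt_sign_cases[of m] alt_sign_cases[of n] s r assms(1,2) by (auto simp: min_def)
  have C: "fold_C x y = max (- min (s * \<xi>) (1 - r * \<upsilon>)) (min (min (s * \<xi>) (1 - r * \<upsilon>)) (1 - r * \<upsilon> - s * \<xi>))"
    unfolding fold_C_def A ax ay ..
  show "fold_W x y = \<kappa> * s * max (- min (s * \<xi>) (1 - r * \<upsilon>)) (min (min (s * \<xi>) (1 - r * \<upsilon>)) (1 - r * \<upsilon> - s * \<xi>))"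
  \<comment> \<open>Where one of the two waves vanishes, so does \<open>fold_A\<close>, and both
    sides are 0.\<close>
  proof (cases "s * \<xi> = 0 \<or> 1 - r * \<upsilon> = 0")
    case True
    then show ?thesis using s r assms(1,2) unfolding fold_W_def C by auto
  next
    case False
    have "sgn (triangle_wave x) = alt_sign m * s"
      unfolding tx using alt_sign_cases[of m] s False by (auto simp: sgn_real_def)
    moreover have "sgn (triangle_wave (y + 1)) = alt_sign n"
      unfolding ty using alt_sign_cases[of n] r False assms(2) by (auto simp: sgn_real_def)
    ultimately show ?thesis unfolding fold_W_def C \<kappa> by simp
  qed
qed

text \<open>The point \<open>(1/2, 0)\<close> is interior to \<open>B\<close>, where the bipyramid
  has positive height. This is why the Zorich map omits 0.\<close>

lemma fold_ne_center:
  assumes "fold_A x y = 1/2" "fold_V x y = 0"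
  shows "fold_W x y \<noteq> 0"
proof -
  obtain m \<xi> where x: "x = 2 * real_of_int m + \<xi>" "\<bar>\<xi>\<bar> \<le> 1" by (rule reduce_mod_2)
  obtain n \<upsilon> where y: "y = 2 * real_of_int n + \<upsilon>" "\<bar>\<upsilon>\<bar> \<le> 1" by (rule reduce_mod_2)
  obtain s :: real where s: "s = 1 \<or> s = -1" "s * \<xi> \<ge> 0"
    by (cases "\<xi> \<ge> 0") (fastforce dest: that[of 1], metis mult_minus1 neg_0_le_iff_le nle_le)
  obtain r :: real where r: "r = 1 \<or> r = -1" "r * \<upsilon> \<ge> 0"
    by (cases "\<upsilon> \<ge> 0") (fastforce dest: that[of 1], metis mult_minus1 neg_0_le_iff_le nle_le)
  note f = fold_values[OF x(2) y(2) x(1) y(1) s r refl]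
  have k: "alt_sign m * alt_sign n \<noteq> 0" using alt_sign_cases[of m] alt_sign_cases[of n] by auto
  have "min (s * \<xi>) (1 - r * \<upsilon>) = 1/2" "min (1 - s * \<xi>) (r * \<upsilon>) = 0"
    using assms k r(1) unfolding f by auto
  then have "max (- min (s * \<xi>) (1 - r * \<upsilon>)) (min (min (s * \<xi>) (1 - r * \<upsilon>)) (1 - r * \<upsilon> - s * \<xi>)) \<noteq> 0"
    by (auto simp: min_def max_def split: if_splits)
  then show ?thesis unfolding f using k s(1) by auto
qed

text \<open>Serves to bound the last column of the derivative, and the map itself for negative
  \<open>t\<close>.\<close>

lemma fold_bounds: "0 \<le> fold_A x y" "fold_A x y \<le> 1" "\<bar>fold_V x y\<bar> \<le> 1" "\<bar>fold_W x y\<bar> \<le> 1"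
proof -
  obtain m \<xi> where x: "x = 2 * real_of_int m + \<xi>" "\<bar>\<xi>\<bar> \<le> 1" by (rule reduce_mod_2)
  obtain n \<upsilon> where y: "y = 2 * real_of_int n + \<upsilon>" "\<bar>\<upsilon>\<bar> \<le> 1" by (rule reduce_mod_2)
  have xv: "\<bar>triangle_wave x\<bar> \<le> 1" "\<bar>triangle_wave (x + 1)\<bar> \<le> 1"
    using triangle_wave_shift[OF x(2), of m] x alt_sign_cases[of m] by auto
  have yv: "\<bar>triangle_wave y\<bar> \<le> 1" "\<bar>triangle_wave (y + 1)\<bar> \<le> 1"
    using triangle_wave_shift[OF y(2), of n] y alt_sign_cases[of n] by auto
  show A: "0 \<le> fold_A x y" "fold_A x y \<le> 1" unfolding fold_A_def using xv by auto
  show "\<bar>fold_V x y\<bar> \<le> 1" unfolding fold_V_def using yv(1) by (auto simp: abs_if split: if_splits)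
  have "\<bar>fold_C x y\<bar> \<le> 1" unfolding fold_C_def using A by linarith
  then show "\<bar>fold_W x y\<bar> \<le> 1" unfolding fold_W_def by (auto simp: sgn_real_def)
qed

definition det3 :: "real \<Rightarrow> real \<Rightarrow> real \<Rightarrow> real \<Rightarrow> real \<Rightarrow> real \<Rightarrow> real \<Rightarrow> real \<Rightarrow> real \<Rightarrow> real" where
  "det3 a b c d e f g h k = a * (e * k - f * h) - b * (d * k - f * g) + c * (d * h - e * g)"

text \<open>
  The third column is \<open>\<zeta>\<close> itself, the derivative of \<open>e\<^sup>t \<zeta>\<close> in \<open>t\<close> up to the factor \<open>e\<^sup>t\<close>; the apex of
  both pyramids lies at height \<open>1/2\<close> over the point \<open>(1/2, 0)\<close> of \<open>B\<close>, so the determinant is the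
  height of the apex.
\<close>
lemma fold_locally_affine:
  assumes gen: "\<And>i j k :: int. i > 0 \<Longrightarrow> real_of_int i * x + real_of_int j * y \<noteq> real_of_int k"
    and geny: "\<And>k :: int. y \<noteq> real_of_int k"
  shows "\<exists>a1 a2 v1 v2 w1 w2 e. e > 0 \<and>
    \<bar>a1\<bar> \<le> 1 \<and> \<bar>a2\<bar> \<le> 1 \<and> \<bar>v1\<bar> \<le> 1 \<and> \<bar>v2\<bar> \<le> 1 \<and> \<bar>w1\<bar> \<le> 1 \<and> \<bar>w2\<bar> \<le> 1 \<and>
    det3 a1 a2 (fold_A x y - 1/2) v1 v2 (fold_V x y) w1 w2 (fold_W x y) = 1/2 \<and>
    (\<forall>x' y'. \<bar>x' - x\<bar> < e \<longrightarrow> \<bar>y' - y\<bar> < e \<longrightarrow>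
      fold_A x' y' = fold_A x y + a1 * (x' - x) + a2 * (y' - y) \<and>
      fold_V x' y' = fold_V x y + v1 * (x' - x) + v2 * (y' - y) \<and>
      fold_W x' y' = fold_W x y + w1 * (x' - x) + w2 * (y' - y))"
proof -
  obtain m \<xi> where x: "x = 2 * real_of_int m + \<xi>" "\<bar>\<xi>\<bar> \<le> 1" by (rule reduce_mod_2)
  obtain n \<upsilon> where y: "y = 2 * real_of_int n + \<upsilon>" "\<bar>\<upsilon>\<bar> \<le> 1" by (rule reduce_mod_2)
  obtain s :: real where s: "s = 1 \<or> s = -1" "s * \<xi> \<ge> 0"
    by (cases "\<xi> \<ge> 0") (fastforce dest: that[of 1], metis mult_minus1 neg_0_le_iff_le nle_le)
  obtain r :: real where r: "r = 1 \<or> r = -1" "r * \<upsilon> \<ge> 0"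
    by (cases "\<upsilon> \<ge> 0") (fastforce dest: that[of 1], metis mult_minus1 neg_0_le_iff_le nle_le)
  define \<kappa> where "\<kappa> = alt_sign m * alt_sign n"
  have \<kappa>: "\<kappa> = 1 \<or> \<kappa> = -1" unfolding \<kappa>_def using alt_sign_cases[of m] alt_sign_cases[of n] by auto
  define p where "p = s * \<xi>"
  define q where "q = r * \<upsilon>"
  \<comment> \<open>All kink lines in integer form: the boundaries and axes of the cells, the
    slanted mirrors, and the ridges \<open>2 * p + q = 1\<close> and \<open>p + 2 * q = 2\<close>
    where two faces of a pyramid meet.\<close>
  have g: "x \<noteq> real_of_int k" "x + y \<noteq> real_of_int k" "x - y \<noteq> real_of_int k"
    "2 * x + y \<noteq> real_of_int k" "2 * x - y \<noteq> real_of_int k"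
    "x + 2 * y \<noteq> real_of_int k" "x - 2 * y \<noteq> real_of_int k" for k
    using gen[of 1 0 k] gen[of 1 1 k] gen[of 1 "-1" k] gen[of 2 1 k] gen[of 2 "-1" k]
      gen[of 1 2 k] gen[of 1 "-2" k] by auto
  have p: "0 < p" "p < 1"
    using x s g(1)[of "2 * m"] g(1)[of "2 * m + 1"] g(1)[of "2 * m - 1"] unfolding p_def by auto
  have q: "0 < q" "q < 1"
    using y r geny[of "2 * n"] geny[of "2 * n + 1"] geny[of "2 * n - 1"] unfolding q_def by auto
  have pq: "p + q \<noteq> 1"
    using s(1) r(1) g(2)[of "2*m+2*n+1"] g(2)[of "2*m+2*n-1"] g(3)[of "2*m-2*n+1"] g(3)[of "2*m-2*n-1"]
    unfolding x(1) y(1) p_def q_def by auto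
  have ppq: "2 * p + q \<noteq> 1"
    using s(1) r(1) g(4)[of "4*m+2*n+1"] g(4)[of "4*m+2*n-1"] g(5)[of "4*m-2*n+1"] g(5)[of "4*m-2*n-1"]
    unfolding x(1) y(1) p_def q_def by auto
  have pqq: "p + 2 * q \<noteq> 2"
    using s(1) r(1) g(6)[of "2*m+4*n+2"] g(6)[of "2*m+4*n-2"] g(7)[of "2*m-4*n+2"] g(7)[of "2*m-4*n-2"]
    unfolding x(1) y(1) p_def q_def by auto
  \<comment> \<open>The margins to the kink lines, each divided by the sum of the absolute values of
    its coefficients: changing \<open>p\<close> and \<open>q\<close> by less than \<open>e\<close>
    crosses none of them.\<close>
  define S where "S = {p, 1 - p, q, 1 - q, \<bar>1 - p - q\<bar> / 2, \<bar>1 - 2 * p - q\<bar> / 3, \<bar>2 - p - 2 * q\<bar> / 3}"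
  define e where "e = Min S"
  have S: "finite S" "S \<noteq> {}" unfolding S_def by simp_all
  have "\<forall>z\<in>S. 0 < z" using p q pq ppq pqq unfolding S_def by simp
  then have e0: "e > 0" unfolding e_def using S by simp
  have eS: "e \<le> z" if "z \<in> S" for z
    unfolding e_def using S(1) that by (rule Min_le)
  have e: "e > 0" "e \<le> p" "e \<le> 1 - p" "e \<le> q" "e \<le> 1 - q" "2 * e \<le> \<bar>1 - p - q\<bar>"
    "3 * e \<le> \<bar>1 - 2 * p - q\<bar>" "3 * e \<le> \<bar>2 - p - 2 * q\<bar>"
    using e0 eS[of p] eS[of "1 - p"] eS[of q] eS[of "1 - q"] eS[of "\<bar>1 - p - q\<bar> / 2"]
      eS[of "\<bar>1 - 2 * p - q\<bar> / 3"] eS[of "\<bar>2 - p - 2 * q\<bar> / 3"]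
    by (auto simp: S_def)
  have near: "\<exists>p' q'. p' = p + s * (x' - x) \<and> q' = q + r * (y' - y) \<and> \<bar>p' - p\<bar> < e \<and> \<bar>q' - q\<bar> < e \<and>
      fold_A x' y' = min p' (1 - q') \<and>
      fold_V x' y' = \<kappa> * r * min (1 - p') q' \<and>
      fold_W x' y' = \<kappa> * s * max (- min p' (1 - q')) (min (min p' (1 - q')) (1 - q' - p'))"
    if d: "\<bar>x' - x\<bar> < e" "\<bar>y' - y\<bar> < e" for x' y'
  proof -
    define \<xi>' where "\<xi>' = \<xi> + (x' - x)"
    define \<upsilon>' where "\<upsilon>' = \<upsilon> + (y' - y)"
    have p': "s * \<xi>' = p + s * (x' - x)" and q': "r * \<upsilon>' = q + r * (y' - y)"
      unfolding \<xi>'_def \<upsilon>'_def p_def q_def by (simp_all add: algebra_simps)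
    have dp: "\<bar>s * \<xi>' - p\<bar> < e" unfolding p' using s(1) d(1) by (auto simp: abs_minus_commute)
    have dq: "\<bar>r * \<upsilon>' - q\<bar> < e" unfolding q' using r(1) d(2) by (auto simp: abs_minus_commute)
    have b: "0 \<le> s * \<xi>'" "s * \<xi>' \<le> 1" "0 \<le> r * \<upsilon>'" "r * \<upsilon>' \<le> 1"
      using dp dq e by linarith+
    have ab: "\<bar>\<xi>'\<bar> \<le> 1" "\<bar>\<upsilon>'\<bar> \<le> 1" using b s(1) r(1) by auto
    have x': "x' = 2 * real_of_int m + \<xi>'" "y' = 2 * real_of_int n + \<upsilon>'"
      unfolding \<xi>'_def \<upsilon>'_def x(1) y(1) by simp_all
    note f = fold_values[OF ab x' s(1) b(1) r(1) b(3) \<kappa>_def]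
    show ?thesis
      by (intro exI[of _ "s * \<xi>'"] exI[of _ "r * \<upsilon>'"]) (use f p' q' dp dq in blast)
  qed
  have f0: "fold_A x y = min p (1 - q)" "fold_V x y = \<kappa> * r * min (1 - p) q"
      "fold_W x y = \<kappa> * s * max (- min p (1 - q)) (min (min p (1 - q)) (1 - q - p))"
    using near[of x y] e(1) by auto
  \<comment> \<open>It is enough to find affine formulas in \<open>p\<close> and \<open>q\<close>.
    Passing back to \<open>x\<close> and \<open>y\<close> multiplies two columns and two rows by
    signs whose product is \<open>s^2 * r^2 * \<kappa>^2 = 1\<close>: each reflection of the plane
    is paired with a change of pyramid, and orientation is kept.\<close>
  have main: ?thesis
    if c: "\<And>p' q'. \<bar>p' - p\<bar> < e \<Longrightarrow> \<bar>q' - q\<bar> < e \<Longrightarrow>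
        min p' (1 - q') = a0 + a1 * p' + a2 * q' \<and> min (1 - p') q' = v0 + v1 * p' + v2 * q' \<and>
        max (- min p' (1 - q')) (min (min p' (1 - q')) (1 - q' - p')) = w0 + w1 * p' + w2 * q'"
      and bd: "\<bar>a1\<bar> \<le> 1" "\<bar>a2\<bar> \<le> 1" "\<bar>v1\<bar> \<le> 1" "\<bar>v2\<bar> \<le> 1" "\<bar>w1\<bar> \<le> 1" "\<bar>w2\<bar> \<le> 1"
      and dd: "det3 a1 a2 (a0 + a1 * p + a2 * q - 1/2) v1 v2 (v0 + v1 * p + v2 * q) w1 w2 (w0 + w1 * p + w2 * q) = 1/2"
    for a0 a1 a2 v0 v1 v2 w0 w1 w2
  proof -
    have z: "\<bar>p - p\<bar> < e" "\<bar>q - q\<bar> < e" using e(1) by simp_all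
    note c0 = c[OF z, THEN conjunct1] c[OF z, THEN conjunct2, THEN conjunct1]
      c[OF z, THEN conjunct2, THEN conjunct2]
    note v = f0(1)[unfolded c0(1)] f0(2)[unfolded c0(2)] f0(3)[unfolded c0(3)]
    have sq: "s * s = 1" "r * r = 1" "\<kappa> * \<kappa> = 1" using s(1) r(1) \<kappa> by auto
    have det_scale: "det3 (a1 * s) (a2 * r) A (\<kappa> * r * (v1 * s)) (\<kappa> * r * (v2 * r)) (\<kappa> * r * V)
        (\<kappa> * s * (w1 * s)) (\<kappa> * s * (w2 * r)) (\<kappa> * s * W)
        = (s * s) * (r * r) * (\<kappa> * \<kappa>) * det3 a1 a2 A v1 v2 V w1 w2 W" for A V W
      unfolding det3_def by (simp only: algebra_simps)
    have det: "det3 (a1 * s) (a2 * r) (fold_A x y - 1/2) (\<kappa> * r * (v1 * s)) (\<kappa> * r * (v2 * r)) (fold_V x y)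
        (\<kappa> * s * (w1 * s)) (\<kappa> * s * (w2 * r)) (fold_W x y) = 1/2"
      unfolding v det_scale sq mult_1 by (rule dd)
    have aff: "fold_A x' y' = fold_A x y + a1 * s * (x' - x) + a2 * r * (y' - y) \<and>
      fold_V x' y' = fold_V x y + \<kappa> * r * (v1 * s) * (x' - x) + \<kappa> * r * (v2 * r) * (y' - y) \<and>
      fold_W x' y' = fold_W x y + \<kappa> * s * (w1 * s) * (x' - x) + \<kappa> * s * (w2 * r) * (y' - y)"
      if d: "\<bar>x' - x\<bar> < e" "\<bar>y' - y\<bar> < e" for x' y'
    proof -
      obtain p' q' where *: "p' = p + s * (x' - x)" "q' = q + r * (y' - y)" "\<bar>p' - p\<bar> < e" "\<bar>q' - q\<bar> < e"
        "fold_A x' y' = min p' (1 - q')" "fold_V x' y' = \<kappa> * r * min (1 - p') q'"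
        "fold_W x' y' = \<kappa> * s * max (- min p' (1 - q')) (min (min p' (1 - q')) (1 - q' - p'))"
        using near[OF d] by blast
      note c' = c[OF *(3,4), THEN conjunct1] c[OF *(3,4), THEN conjunct2, THEN conjunct1]
        c[OF *(3,4), THEN conjunct2, THEN conjunct2]
      show ?thesis unfolding v *(5)[unfolded c'(1)] *(6)[unfolded c'(2)] *(7)[unfolded c'(3)]
        unfolding *(1,2) by (simp only: algebra_simps)
    qed
    have abs1: "\<bar>s\<bar> = 1" "\<bar>r\<bar> = 1" "\<bar>\<kappa>\<bar> = 1" using s(1) r(1) \<kappa> by (elim disjE; simp)+
    have bds: "\<bar>a1 * s\<bar> \<le> 1" "\<bar>a2 * r\<bar> \<le> 1" "\<bar>\<kappa> * r * (v1 * s)\<bar> \<le> 1" "\<bar>\<kappa> * r * (v2 * r)\<bar> \<le> 1"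
      "\<bar>\<kappa> * s * (w1 * s)\<bar> \<le> 1" "\<bar>\<kappa> * s * (w2 * r)\<bar> \<le> 1"
      using bd unfolding abs_mult abs1 by simp_all
    show ?thesis
      by (rule exI[of _ "a1 * s"], rule exI[of _ "a2 * r"], rule exI[of _ "\<kappa> * r * (v1 * s)"],
          rule exI[of _ "\<kappa> * r * (v2 * r)"], rule exI[of _ "\<kappa> * s * (w1 * s)"],
          rule exI[of _ "\<kappa> * s * (w2 * r)"], rule exI[of _ e])
        (intro conjI e(1) bds det, intro allI impI, rule aff)
  qed
  \<comment> \<open>The region \<open>p + q < 1\<close> is a half of \<open>B\<close>, and
    \<open>p + q > 1\<close> is its mirror image in a short side; the second inequality selects the
    face of the pyramid.\<close>
  consider "p + q < 1" "2 * p + q < 1" | "p + q < 1" "2 * p + q > 1"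
    | "p + q > 1" "p + 2 * q < 2" | "p + q > 1" "p + 2 * q > 2"
    using pq ppq pqq by linarith
  then show ?thesis
  proof cases
    case 1
    have e': "2 * e \<le> 1 - p - q" "3 * e \<le> 1 - 2 * p - q" using e(6-8) 1 by linarith+
    show ?thesis
    proof (rule main[of 0 1 0 0 0 1 0 1 0])
      fix p' q' :: real assume "\<bar>p' - p\<bar> < e" "\<bar>q' - q\<bar> < e"
      then have "p - e < p'" "p' < p + e" "q - e < q'" "q' < q + e" by linarith+
      then have "p' + q' < 1" "2 * p' + q' < 1" "0 < p'" "p' < 1" "0 < q'" "q' < 1"
        using e' e(2-5) by linarith+
      then show "min p' (1 - q') = 0 + 1 * p' + 0 * q' \<and> min (1 - p') q' = 0 + 0 * p' + 1 * q' \<and>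
        max (- min p' (1 - q')) (min (min p' (1 - q')) (1 - q' - p')) = 0 + 1 * p' + 0 * q'"
        by (simp add: min_absorb1 min_absorb2 max_absorb1 max_absorb2)
    qed (simp_all add: det3_def algebra_simps)
  next
    case 2
    have e': "2 * e \<le> 1 - p - q" "3 * e \<le> 2 * p + q - 1" using e(6-8) 2 by linarith+
    show ?thesis
    proof (rule main[of 0 1 0 0 0 1 1 "-1" "-1"])
      fix p' q' :: real assume "\<bar>p' - p\<bar> < e" "\<bar>q' - q\<bar> < e"
      then have "p - e < p'" "p' < p + e" "q - e < q'" "q' < q + e" by linarith+
      then have "p' + q' < 1" "2 * p' + q' > 1" "0 < p'" "p' < 1" "0 < q'" "q' < 1"
        using e' e(2-5) by linarith+
      then show "min p' (1 - q') = 0 + 1 * p' + 0 * q' \<and> min (1 - p') q' = 0 + 0 * p' + 1 * q' \<and>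
        max (- min p' (1 - q')) (min (min p' (1 - q')) (1 - q' - p')) = 1 + -1 * p' + -1 * q'"
        by (simp add: min_absorb1 min_absorb2 max_absorb1 max_absorb2)
    qed (simp_all add: det3_def algebra_simps)
  next
    case 3
    have e': "2 * e \<le> p + q - 1" "3 * e \<le> 2 - p - 2 * q" using e(6-8) 3 by linarith+
    show ?thesis
    proof (rule main[of 1 0 "-1" 1 "-1" 0 1 "-1" "-1"])
      fix p' q' :: real assume "\<bar>p' - p\<bar> < e" "\<bar>q' - q\<bar> < e"
      then have "p - e < p'" "p' < p + e" "q - e < q'" "q' < q + e" by linarith+
      then have "p' + q' > 1" "p' + 2 * q' < 2" "0 < p'" "p' < 1" "0 < q'" "q' < 1"
        using e' e(2-5) by linarith+
      then show "min p' (1 - q') = 1 + 0 * p' + -1 * q' \<and> min (1 - p') q' = 1 + -1 * p' + 0 * q' \<and>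
        max (- min p' (1 - q')) (min (min p' (1 - q')) (1 - q' - p')) = 1 + -1 * p' + -1 * q'"
        by (simp add: min_absorb1 min_absorb2 max_absorb1 max_absorb2)
    qed (simp_all add: det3_def algebra_simps)
  next
    case 4
    have e': "2 * e \<le> p + q - 1" "3 * e \<le> p + 2 * q - 2" using e(6-8) 4 by linarith+
    show ?thesis
    proof (rule main[of 1 0 "-1" 1 "-1" 0 "-1" 0 1])
      fix p' q' :: real assume "\<bar>p' - p\<bar> < e" "\<bar>q' - q\<bar> < e"
      then have "p - e < p'" "p' < p + e" "q - e < q'" "q' < q + e" by linarith+
      then have "p' + q' > 1" "p' + 2 * q' > 2" "0 < p'" "p' < 1" "0 < q'" "q' < 1"
        using e' e(2-5) by linarith+
      then show "min p' (1 - q') = 1 + 0 * p' + -1 * q' \<and> min (1 - p') q' = 1 + -1 * p' + 0 * q' \<and>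
        max (- min p' (1 - q')) (min (min p' (1 - q')) (1 - q' - p')) = -1 + 0 * p' + 1 * q'"
        by (simp add: min_absorb1 min_absorb2 max_absorb1 max_absorb2)
    qed (simp_all add: det3_def algebra_simps)
  qed
qed

section \<open>The map\<close>

text \<open>
  Since \<open>cap\<close> is the height of \<open>\<zeta>\<close> over the point
  \<open>(wall y t, y)\<close> of \<open>B\<close>, the formulas for the map on the two sides of
  \<open>|x| = cap y t\<close> agree there: the third component of \<open>\<zeta>\<close> equals \<open>|x|\<close>.
\<close>

definition wall :: "real \<Rightarrow> real \<Rightarrow> real" where
  "wall y t = max 0 (min (1/2 - t) (1 - \<bar>y\<bar>))"

definition cap :: "real \<Rightarrow> real \<Rightarrow> real" where
  "cap y t = max 0 (min (wall y t) (1 - wall y t - \<bar>y\<bar>))"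

text \<open>The \<open>max\<close> here and the \<open>min\<close> in \<open>zorich_like\<close>
  merge the two sides of \<open>|x| = cap y t\<close>: outside, \<open>|x|\<close> is shifted by
  \<open>wall - cap\<close>; inside, the abscissa is frozen at \<open>wall\<close>. With a single
  formula, local Lipschitz continuity follows from the closure properties.\<close>

definition sheared :: "real^3 \<Rightarrow> real" where
  "sheared p = max (\<bar>p $ 1\<bar> - cap (p $ 2) (p $ 3)) 0 + wall (p $ 2) (p $ 3)"

definition zorich_like :: "real^3 \<Rightarrow> real^3" where
  "zorich_like p = exp (p $ 3) *\<^sub>R vector [fold_A (sheared p) (p $ 2) - 1/2, fold_V (sheared p) (p $ 2),
     sgn (p $ 1) * (fold_W (sheared p) (p $ 2) + min (\<bar>p $ 1\<bar> - cap (p $ 2) (p $ 3)) 0)]"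

section \<open>Agreement of the two formulas and the only zero\<close>

lemma cap_nonneg: "0 \<le> cap y t"
  by (simp add: cap_def)

text \<open>The hypotheses place \<open>(b, y)\<close> in the triangle \<open>B\<close>, on which
  the folding is the identity; it lies in the cell \<open>m = n = 0\<close>.\<close>

lemma fold_base:
  assumes "0 \<le> b" "b \<le> 1 - \<bar>y\<bar>"
  shows "fold_A b y = b" "fold_V b y = y" "fold_W b y = min b (1 - b - \<bar>y\<bar>)"
proof -
  define r :: real where "r = (if y \<ge> 0 then 1 else -1)"
  have r: "r = 1 \<or> r = -1" "r * y \<ge> 0" "r * y = \<bar>y\<bar>" by (auto simp: r_def)
  have rr: "r * \<bar>y\<bar> = y" by (auto simp: r_def)
  have "\<bar>b\<bar> \<le> 1" "\<bar>y\<bar> \<le> 1" using assms by auto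
  note f = fold_values[OF this, of b 0 y 0 1 r 1, unfolded r(3)]
  show "fold_A b y = b" "fold_V b y = y" "fold_W b y = min b (1 - b - \<bar>y\<bar>)"
    using f(1-3) assms r(1) rr by (auto simp: alt_sign_def min_def max_def split: if_splits)
qed

lemma fold_W_0: "fold_W 0 y = 0"
  using triangle_wave_shift(1)[of 0 0] by (simp add: fold_W_def alt_sign_def)

text \<open>Joins the inner formula to the outer one, and makes the third component vanish at
  \<open>x = 0\<close>, as the reflection requires. For \<open>|y| > 1\<close> both sides are 0,
  since the line \<open>x = 0\<close> is a mirror.\<close>

lemma fold_W_wall: "fold_W (wall y t) y = cap y t"
proof (cases "\<bar>y\<bar> \<le> 1")
  case True
  then have w: "0 \<le> wall y t" "wall y t \<le> 1 - \<bar>y\<bar>" by (auto simp: wall_def)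
  show ?thesis unfolding fold_base(3)[OF w] cap_def using w by simp
next
  case False
  then have "wall y t = 0" by (auto simp: wall_def)
  then show ?thesis using False by (auto simp: fold_W_0 cap_def)
qed

text \<open>Positive height means an interior point of \<open>B\<close>, so that neither bound in
  the definition of \<open>wall\<close> is active.\<close>

lemma cap_posD:
  assumes "cap y t > 0"
  shows "wall y t = 1/2 - t" "\<bar>y\<bar> < 1" "\<bar>t\<bar> < 1/2" "cap y t \<le> 1/2"
proof -
  have w: "wall y t > 0" "wall y t < 1 - \<bar>y\<bar>" "cap y t \<le> wall y t" "cap y t \<le> 1 - wall y t - \<bar>y\<bar>"
    using assms unfolding cap_def by (auto simp: less_max_iff_disj)
  then show eq: "wall y t = 1/2 - t" unfolding wall_def by (auto simp: less_max_iff_disj min_def split: if_splits)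
  show "\<bar>y\<bar> < 1" "\<bar>t\<bar> < 1/2" "cap y t \<le> 1/2" using w eq by linarith+
qed

lemma zorich_like_inside:
  assumes "\<bar>p $ 1\<bar> < cap (p $ 2) (p $ 3)"
  shows "zorich_like p = exp (p $ 3) *\<^sub>R vector [- p $ 3, p $ 2, p $ 1]"
proof -
  have pos: "cap (p $ 2) (p $ 3) > 0" using assms by linarith
  have w: "0 \<le> wall (p $ 2) (p $ 3)" "wall (p $ 2) (p $ 3) \<le> 1 - \<bar>p $ 2\<bar>"
    using cap_posD(2)[OF pos] by (auto simp: wall_def)
  have sh: "sheared p = wall (p $ 2) (p $ 3)" using assms by (simp add: sheared_def)
  have "sgn (p $ 1) * (cap (p $ 2) (p $ 3) + min (\<bar>p $ 1\<bar> - cap (p $ 2) (p $ 3)) 0) = p $ 1"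
    using assms by (simp add: sgn_mult_abs)
  then show ?thesis
    unfolding zorich_like_def sh fold_W_wall fold_base(1,2)[OF w]
    using cap_posD(1)[OF pos] by simp
qed

lemma zorich_like_outside:
  assumes "\<bar>p $ 1\<bar> \<ge> cap (p $ 2) (p $ 3)"
  shows "sheared p = \<bar>p $ 1\<bar> + (wall (p $ 2) (p $ 3) - cap (p $ 2) (p $ 3))"
    "zorich_like p = exp (p $ 3) *\<^sub>R vector [fold_A (sheared p) (p $ 2) - 1/2, fold_V (sheared p) (p $ 2),
     sgn (p $ 1) * fold_W (sheared p) (p $ 2)]"
  using assms by (simp_all add: zorich_like_def sheared_def)

lemma vector_3_eq_0: "(vector [a, b, c] :: real^3) = 0 \<longleftrightarrow> a = 0 \<and> b = 0 \<and> c = 0"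
  by (simp add: vec_eq_iff forall_3)

lemma zorich_like_eq_0_iff: "zorich_like p = 0 \<longleftrightarrow> p = 0"
proof (cases "\<bar>p $ 1\<bar> < cap (p $ 2) (p $ 3)")
  case True
  show ?thesis unfolding zorich_like_inside[OF True]
    by (auto simp: vector_3_eq_0 vec_eq_iff[of p 0] forall_3)
next
  case False
  then have le: "\<bar>p $ 1\<bar> \<ge> cap (p $ 2) (p $ 3)" by simp
  \<comment> \<open>At the origin \<open>cap\<close> is \<open>1/2\<close>, so the origin belongs to
    the inner region.\<close>
  have "p \<noteq> 0" using False by (auto simp: cap_def wall_def)
  moreover have "zorich_like p \<noteq> 0"
  proof
    assume "zorich_like p = 0"
    then have z: "fold_A (sheared p) (p $ 2) = 1/2" "fold_V (sheared p) (p $ 2) = 0"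
      "p $ 1 = 0 \<or> fold_W (sheared p) (p $ 2) = 0"
      unfolding zorich_like_outside(2)[OF le] by (auto simp: vector_3_eq_0 sgn_eq_0_iff)
    \<comment> \<open>Over the centre of \<open>B\<close> the height is nonzero, which leaves only
      \<open>x = 0\<close>. In the outer region this gives \<open>cap = 0\<close>, whereas the
      height at \<open>x = 0\<close> equals \<open>cap\<close>.\<close>
    then have "p $ 1 = 0" "fold_W (sheared p) (p $ 2) \<noteq> 0" using fold_ne_center by blast+
    moreover have "cap (p $ 2) (p $ 3) = 0"
      using le cap_nonneg[of "p $ 2" "p $ 3"] \<open>p $ 1 = 0\<close> by simp
    then have "fold_W (sheared p) (p $ 2) = 0"
      unfolding zorich_like_outside(1)[OF le] using \<open>p $ 1 = 0\<close> fold_W_wall[of "p $ 2" "p $ 3"] by simp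
    ultimately show False by blast
  qed
  ultimately show ?thesis by blast
qed

text \<open>In the outer region only the shift \<open>wall - cap\<close> enters. Its pieces are 0,
  \<open>1 - |y|\<close> and \<open>|y| - 2 * t\<close>, whence the slope bound 2; the excluded
  lines contain all its kinks.\<close>

lemma wall_cap_locally_affine:
  assumes "y \<noteq> 0" "\<bar>y\<bar> \<noteq> 1" "t \<noteq> 1/2" "t \<noteq> \<bar>y\<bar> - 1/2" "t \<noteq> \<bar>y\<bar> / 2"
  shows "\<exists>b1 b2 e. e > 0 \<and> \<bar>b1\<bar> \<le> 2 \<and> \<bar>b2\<bar> \<le> 2 \<and>
    (\<forall>y' t'. \<bar>y' - y\<bar> < e \<longrightarrow> \<bar>t' - t\<bar> < e \<longrightarrow>
      wall y' t' - cap y' t' = wall y t - cap y t + b1 * (y' - y) + b2 * (t' - t))"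
proof -
  define r :: real where "r = (if y \<ge> 0 then 1 else -1)"
  have r: "r = 1 \<or> r = -1" "r * y = \<bar>y\<bar>" by (auto simp: r_def)
  define q where "q = r * y"
  have q: "q = \<bar>y\<bar>" "q > 0" unfolding q_def r(2) using assms(1) by auto
  define S where "S = {q, \<bar>1 - q\<bar>, \<bar>t - 1/2\<bar>, \<bar>t - q + 1/2\<bar> / 2, \<bar>2 * t - q\<bar> / 3}"
  define e where "e = Min S"
  have S: "finite S" "S \<noteq> {}" unfolding S_def by simp_all
  have "\<forall>z\<in>S. 0 < z" using assms q(2) unfolding S_def q(1) by simp
  then have e0: "e > 0" unfolding e_def using S by simp
  have eS: "e \<le> z" if "z \<in> S" for z
    unfolding e_def using S(1) that by (rule Min_le)
  have e: "e > 0" "e \<le> q" "e \<le> \<bar>1 - q\<bar>" "e \<le> \<bar>t - 1/2\<bar>" "2 * e \<le> \<bar>t - q + 1/2\<bar>" "3 * e \<le> \<bar>2 * t - q\<bar>"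
    using e0 eS[of q] eS[of "\<bar>1 - q\<bar>"] eS[of "\<bar>t - 1/2\<bar>"] eS[of "\<bar>t - q + 1/2\<bar> / 2"] eS[of "\<bar>2 * t - q\<bar> / 3"]
    by (auto simp: S_def)
  have abs': "\<bar>y'\<bar> = q + r * (y' - y) \<and> \<bar>\<bar>y'\<bar> - q\<bar> < e" if "\<bar>y' - y\<bar> < e" for y'
  proof -
    have "0 < r * y'" using r(1) that e(2) unfolding q_def by (auto simp: abs_less_iff)
    then have "\<bar>y'\<bar> = r * y'" using r(1) by (elim disjE) simp_all
    moreover have "r * y' = q + r * (y' - y)" unfolding q_def by (simp add: algebra_simps)
    moreover have "\<bar>r * (y' - y)\<bar> < e" using r(1) that by (elim disjE) (simp_all add: abs_minus_commute)
    ultimately show ?thesis by simp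
  qed
  have main: ?thesis
    if c: "\<And>q' t'. \<bar>q' - q\<bar> < e \<Longrightarrow> \<bar>t' - t\<bar> < e \<Longrightarrow>
        max 0 (min (1/2 - t') (1 - q')) - max 0 (min (max 0 (min (1/2 - t') (1 - q'))) (1 - max 0 (min (1/2 - t') (1 - q')) - q'))
        = c0 + c1 * q' + c2 * t'" and bd: "\<bar>c1\<bar> \<le> 2" "\<bar>c2\<bar> \<le> 2" for c0 c1 c2
  proof (rule exI[of _ "c1 * r"], rule exI[of _ c2], rule exI[of _ e], intro conjI allI impI)
    fix y' t' assume d: "\<bar>y' - y\<bar> < e" "\<bar>t' - t\<bar> < e"
    have 1: "wall y' t' - cap y' t' = c0 + c1 * \<bar>y'\<bar> + c2 * t'"
      unfolding wall_def cap_def using c[of "\<bar>y'\<bar>" t'] abs'[OF d(1)] d(2) by blast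
    have z: "\<bar>q - q\<bar> < e" "\<bar>t - t\<bar> < e" using e(1) by simp_all
    have 2: "wall y t - cap y t = c0 + c1 * \<bar>y\<bar> + c2 * t"
      unfolding wall_def cap_def using c[of q t] z unfolding q(1) by blast
    show "wall y' t' - cap y' t' = wall y t - cap y t + c1 * r * (y' - y) + c2 * (t' - t)"
      unfolding 1 2 q(1)[symmetric] abs'[OF d(1), THEN conjunct1] by (simp only: algebra_simps)
  next
    show "\<bar>c1 * r\<bar> \<le> 2" using bd(1) r(1) by (elim disjE) simp_all
  qed (use e(1) bd(2) in simp_all)
  \<comment> \<open>In this order: \<open>wall = 0\<close> twice, \<open>wall = 1 - |y|\<close> with
    \<open>cap = 0\<close>, then \<open>cap = wall\<close>, and last
    \<open>cap = 1 - wall - |y|\<close>.\<close>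
  consider "t > 1/2" | "q > 1" | "t < 1/2" "q < 1" "1/2 - t > 1 - q"
    | "t < 1/2" "q < 1" "1/2 - t < 1 - q" "2 * t > q" | "t < 1/2" "q < 1" "1/2 - t < 1 - q" "2 * t < q"
    using assms(2-5) unfolding q(1) by linarith
  then show ?thesis
  proof cases
    case 1
    have e': "e \<le> t - 1/2" using e(3-6) 1 by linarith+
    show ?thesis
    proof (rule main[of 0 0 0])
      fix q' t' :: real assume "\<bar>q' - q\<bar> < e" "\<bar>t' - t\<bar> < e"
      then have "q - e < q'" "q' < q + e" "t - e < t'" "t' < t + e" by linarith+
      then have h: "t' > 1/2" "0 < q'" using e' e(2) by linarith+
      then have w: "max 0 (min (1/2 - t') (1 - q')) = 0"
        by (simp add: min_def max_def)
      show "max 0 (min (1/2 - t') (1 - q')) - max 0 (min (max 0 (min (1/2 - t') (1 - q'))) (1 - max 0 (min (1/2 - t') (1 - q')) - q'))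
        = 0 + 0 * q' + 0 * t'"
        unfolding w using h by (simp add: min_def max_def)
    qed simp_all
  next
    case 2
    have e': "e \<le> q - 1" using e(3-6) 2 by linarith+
    show ?thesis
    proof (rule main[of 0 0 0])
      fix q' t' :: real assume "\<bar>q' - q\<bar> < e" "\<bar>t' - t\<bar> < e"
      then have "q - e < q'" "q' < q + e" "t - e < t'" "t' < t + e" by linarith+
      then have h: "q' > 1" "0 < q'" using e' e(2) by linarith+
      then have w: "max 0 (min (1/2 - t') (1 - q')) = 0"
        by (simp add: min_def max_def)
      show "max 0 (min (1/2 - t') (1 - q')) - max 0 (min (max 0 (min (1/2 - t') (1 - q'))) (1 - max 0 (min (1/2 - t') (1 - q')) - q'))
        = 0 + 0 * q' + 0 * t'"
        unfolding w using h by (simp add: min_def max_def)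
    qed simp_all
  next
    case 3
    have e': "e \<le> 1 - q" "2 * e \<le> q - t - 1/2" using e(3-6) 3 by linarith+
    show ?thesis
    proof (rule main[of 1 "-1" 0])
      fix q' t' :: real assume "\<bar>q' - q\<bar> < e" "\<bar>t' - t\<bar> < e"
      then have "q - e < q'" "q' < q + e" "t - e < t'" "t' < t + e" by linarith+
      then have h: "q' < 1" "1/2 - t' > 1 - q'" "0 < q'" using e' e(2) by linarith+
      then have w: "max 0 (min (1/2 - t') (1 - q')) = 1 - q'"
        by (simp add: min_def max_def)
      show "max 0 (min (1/2 - t') (1 - q')) - max 0 (min (max 0 (min (1/2 - t') (1 - q'))) (1 - max 0 (min (1/2 - t') (1 - q')) - q'))
        = 1 + -1 * q' + 0 * t'"
        unfolding w using h by (simp add: min_def max_def)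
    qed simp_all
  next
    case 4
    have e': "e \<le> 1/2 - t" "e \<le> 1 - q" "2 * e \<le> t - q + 1/2" "3 * e \<le> 2 * t - q" using e(3-6) 4 by linarith+
    show ?thesis
    proof (rule main[of 0 0 0])
      fix q' t' :: real assume "\<bar>q' - q\<bar> < e" "\<bar>t' - t\<bar> < e"
      then have "q - e < q'" "q' < q + e" "t - e < t'" "t' < t + e" by linarith+
      then have h: "t' < 1/2" "q' < 1" "1/2 - t' < 1 - q'" "2 * t' > q'" "0 < q'" using e' e(2) by linarith+
      then have w: "max 0 (min (1/2 - t') (1 - q')) = 1/2 - t'"
        by (simp add: min_def max_def)
      show "max 0 (min (1/2 - t') (1 - q')) - max 0 (min (max 0 (min (1/2 - t') (1 - q'))) (1 - max 0 (min (1/2 - t') (1 - q')) - q'))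
        = 0 + 0 * q' + 0 * t'"
        unfolding w using h by (simp add: min_def max_def)
    qed simp_all
  next
    case 5
    have e': "e \<le> 1/2 - t" "e \<le> 1 - q" "2 * e \<le> t - q + 1/2" "3 * e \<le> q - 2 * t" using e(3-6) 5 by linarith+
    show ?thesis
    proof (rule main[of 0 1 "-2"])
      fix q' t' :: real assume "\<bar>q' - q\<bar> < e" "\<bar>t' - t\<bar> < e"
      then have "q - e < q'" "q' < q + e" "t - e < t'" "t' < t + e" by linarith+
      then have h: "t' < 1/2" "q' < 1" "1/2 - t' < 1 - q'" "2 * t' < q'" "0 < q'" using e' e(2) by linarith+
      then have w: "max 0 (min (1/2 - t') (1 - q')) = 1/2 - t'"
        by (simp add: min_def max_def)
      show "max 0 (min (1/2 - t') (1 - q')) - max 0 (min (max 0 (min (1/2 - t') (1 - q'))) (1 - max 0 (min (1/2 - t') (1 - q')) - q'))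
        = 0 + 1 * q' + -2 * t'"
        unfolding w using h by (simp add: min_def max_def)
    qed simp_all
  qed
qed

section \<open>Local Lipschitz continuity of the map\<close>

lemma locally_lipschitz_triangle_wave:
  "locally_lipschitz f \<Longrightarrow> locally_lipschitz (\<lambda>p. triangle_wave (f p))"
  using triangle_wave_lipschitz by (rule locally_lipschitz_compose_1[rotated])

lemma locally_lipschitz_divide_const:
  "locally_lipschitz f \<Longrightarrow> locally_lipschitz (\<lambda>p. f p / c)"
  unfolding divide_inverse by (intro locally_lipschitz_mult locally_lipschitz_const)

lemmas locally_lipschitz_intros = locally_lipschitz_const locally_lipschitz_nth locally_lipschitz_add
  locally_lipschitz_mult locally_lipschitz_divide_const locally_lipschitz_diff locally_lipschitz_uminus
  locally_lipschitz_abs locally_lipschitz_max locally_lipschitz_min locally_lipschitz_exp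
  locally_lipschitz_triangle_wave

lemma locally_lipschitz_wall: "locally_lipschitz (\<lambda>p::real^3. wall (p $ 2) (p $ 3))"
  unfolding wall_def by (intro locally_lipschitz_intros)

lemma locally_lipschitz_cap: "locally_lipschitz (\<lambda>p::real^3. cap (p $ 2) (p $ 3))"
  unfolding cap_def by (intro locally_lipschitz_intros locally_lipschitz_wall)

lemma locally_lipschitz_sheared: "locally_lipschitz sheared"
proof -
  have "locally_lipschitz (\<lambda>p. sheared p)"
    unfolding sheared_def by (intro locally_lipschitz_intros locally_lipschitz_wall locally_lipschitz_cap)
  then show ?thesis by simp
qed

lemma locally_lipschitz_fold:
  assumes "locally_lipschitz f" "locally_lipschitz g"
  shows "locally_lipschitz (\<lambda>p. fold_A (f p) (g p))" "locally_lipschitz (\<lambda>p. fold_V (f p) (g p))"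
    "locally_lipschitz (\<lambda>p. fold_W (f p) (g p))"
proof -
  show A: "locally_lipschitz (\<lambda>p. fold_A (f p) (g p))"
    unfolding fold_A_def by (intro locally_lipschitz_intros assms)
  show "locally_lipschitz (\<lambda>p. fold_V (f p) (g p))"
    unfolding fold_V_def by (intro locally_lipschitz_intros assms)
  have C: "locally_lipschitz (\<lambda>p. fold_C (f p) (g p))"
    unfolding fold_C_def by (intro locally_lipschitz_intros assms A)
  show "locally_lipschitz (\<lambda>p. fold_W (f p) (g p))"
    unfolding fold_W_def
    by (intro locally_lipschitz_sgn_mult locally_lipschitz_triangle_wave locally_lipschitz_add
        locally_lipschitz_const assms C)
      (simp_all add: fold_C_def fold_A_def)
qed

lemma locally_lipschitz_zorich_like: "locally_lipschitz (\<lambda>p. zorich_like p $ i)"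
proof -
  note f = locally_lipschitz_fold[OF locally_lipschitz_sheared locally_lipschitz_nth[of 2]]
  have c3: "locally_lipschitz (\<lambda>p. sgn (p $ 1) * (fold_W (sheared p) (p $ 2) + min (\<bar>p $ 1\<bar> - cap (p $ 2) (p $ 3)) 0))"
  proof (rule locally_lipschitz_sgn_mult)
    show "locally_lipschitz (\<lambda>p. fold_W (sheared p) (p $ 2) + min (\<bar>p $ 1\<bar> - cap (p $ 2) (p $ 3)) 0)"
      by (intro locally_lipschitz_intros locally_lipschitz_cap f)
    fix p :: "real^3" assume "p $ 1 = 0"
    then show "fold_W (sheared p) (p $ 2) + min (\<bar>p $ 1\<bar> - cap (p $ 2) (p $ 3)) 0 = 0"
      using cap_nonneg[of "p $ 2" "p $ 3"] by (simp add: sheared_def fold_W_wall)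
  qed (rule locally_lipschitz_nth)
  consider "i = 1" | "i = 2" | "i = 3" using exhaust_3 by blast
  then show ?thesis
    unfolding zorich_like_def
    by cases (simp_all, (intro locally_lipschitz_intros c3 f)+)
qed

section \<open>Exceptional sets of measure zero\<close>

lemma AE_if_negligible: "negligible {p. Q p} \<Longrightarrow> AE p in lebesgue. \<not> Q p"
  using AE_not_in[of "{p. Q p}" lebesgue] by (simp add: negligible_iff_null_sets)

lemma AE_not_abs_graph:
  fixes g :: "real^'n \<Rightarrow> real"
  assumes "locally_lipschitz g" "\<And>p s. g (p + s *\<^sub>R axis i 1) = g p"
  shows "AE p in lebesgue. \<bar>p $ i\<bar> \<noteq> g p"
proof -
  have "negligible {p. p $ i = g p}"
    using assms by (rule negligible_graph)
  moreover have "negligible {p. p $ i = - g p}"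
    using assms by (intro negligible_graph locally_lipschitz_uminus) simp_all
  ultimately have "AE p in lebesgue. p $ i \<noteq> g p" "AE p in lebesgue. p $ i \<noteq> - g p"
    by (auto dest: AE_if_negligible)
  then show ?thesis by eventually_elim linarith
qed

text \<open>
  The last condition, for all integers \<open>i, j, k\<close>, keeps the sheared point off every line along
  which the folding has a kink, with no need to list these lines.
\<close>

definition generic :: "real^3 \<Rightarrow> bool" where
  "generic p \<longleftrightarrow> p $ 1 \<noteq> 0 \<and> \<bar>p $ 1\<bar> \<noteq> cap (p $ 2) (p $ 3) \<and>
     (\<forall>k::int. p $ 2 \<noteq> real_of_int k) \<and>
     p $ 3 \<noteq> 1/2 \<and> p $ 3 \<noteq> \<bar>p $ 2\<bar> - 1/2 \<and> p $ 3 \<noteq> \<bar>p $ 2\<bar> / 2 \<and>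
     (\<forall>i j k::int. i > 0 \<longrightarrow>
       real_of_int i * (\<bar>p $ 1\<bar> + (wall (p $ 2) (p $ 3) - cap (p $ 2) (p $ 3))) + real_of_int j * p $ 2
         \<noteq> real_of_int k)"

lemma genericD:
  assumes "generic p"
  shows "p $ 1 \<noteq> 0" "\<bar>p $ 1\<bar> \<noteq> cap (p $ 2) (p $ 3)" "p $ 2 \<noteq> real_of_int k"
    "p $ 3 \<noteq> 1/2" "p $ 3 \<noteq> \<bar>p $ 2\<bar> - 1/2" "p $ 3 \<noteq> \<bar>p $ 2\<bar> / 2"
    and "i > 0 \<Longrightarrow> real_of_int i * (\<bar>p $ 1\<bar> + (wall (p $ 2) (p $ 3) - cap (p $ 2) (p $ 3))) + real_of_int j * p $ 2
         \<noteq> real_of_int k"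
  using assms unfolding generic_def by simp_all

lemma AE_generic: "AE p in lebesgue. generic p"
proof -
  have 1: "AE p::real^3 in lebesgue. \<bar>p $ 1\<bar> \<noteq> 0"
    by (rule AE_not_abs_graph) (intro locally_lipschitz_const, simp)
  have 2: "AE p::real^3 in lebesgue. \<bar>p $ 1\<bar> \<noteq> cap (p $ 2) (p $ 3)"
    by (rule AE_not_abs_graph[OF locally_lipschitz_cap]) (simp add: axis_def)
  have 3: "AE p::real^3 in lebesgue. \<forall>k::int. p $ 2 \<noteq> real_of_int k"
    unfolding AE_all_countable
    by (intro allI AE_if_negligible negligible_graph locally_lipschitz_const) simp
  have 4: "AE p::real^3 in lebesgue. p $ 3 \<noteq> 1/2" "AE p::real^3 in lebesgue. p $ 3 \<noteq> \<bar>p $ 2\<bar> - 1/2"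
    "AE p::real^3 in lebesgue. p $ 3 \<noteq> \<bar>p $ 2\<bar> / 2"
    by (intro AE_if_negligible negligible_graph locally_lipschitz_intros; simp add: axis_def)+
  \<comment> \<open>As \<open>i > 0\<close>, the equation can be solved for \<open>|x|\<close> and
    describes a graph over \<open>(y, t)\<close>; only countably many triples occur.\<close>
  have "AE p::real^3 in lebesgue. real_of_int i * (\<bar>p $ 1\<bar> + (wall (p $ 2) (p $ 3) - cap (p $ 2) (p $ 3)))
      + real_of_int j * p $ 2 \<noteq> real_of_int k" if i: "i > 0" for i j k :: int
  proof -
    have "AE p::real^3 in lebesgue. \<bar>p $ 1\<bar> \<noteq>
        (real_of_int k - real_of_int j * p $ 2) / real_of_int i - (wall (p $ 2) (p $ 3) - cap (p $ 2) (p $ 3))"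
      by (rule AE_not_abs_graph)
        (intro locally_lipschitz_intros locally_lipschitz_wall locally_lipschitz_cap, simp add: axis_def)
    then show ?thesis
      by eventually_elim (use i in \<open>auto simp: field_simps\<close>)
  qed
  then have 5: "AE p::real^3 in lebesgue. \<forall>i j k::int. i > 0 \<longrightarrow>
       real_of_int i * (\<bar>p $ 1\<bar> + (wall (p $ 2) (p $ 3) - cap (p $ 2) (p $ 3))) + real_of_int j * p $ 2
         \<noteq> real_of_int k"
    unfolding AE_all_countable by auto
  from 1 2 3 4 5 show ?thesis
    by eventually_elim (simp add: generic_def)
qed

section \<open>The derivative at generic points\<close>

lemma exp_affine_has_derivative:
  fixes G :: "real^3 \<Rightarrow> real"
  assumes "\<forall>\<^sub>F q in nhds p. G q = exp (q $ 3) * (f + l1 * (q $ 1 - p $ 1) + l2 * (q $ 2 - p $ 2) + l3 * (q $ 3 - p $ 3))"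
  shows "(G has_derivative (\<lambda>h. exp (p $ 3) * (l1 * h $ 1 + l2 * h $ 2 + (l3 + f) * h $ 3))) (at p)"
proof -
  have n: "((\<lambda>q::real^3. q $ i) has_derivative (\<lambda>h. h $ i)) (at p)" for i
    by (rule bounded_linear_imp_has_derivative[OF bounded_linear_vec_nth])
  \<comment> \<open>The product rule adds the value \<open>f\<close> to the slope in
    \<open>t\<close>, which is how \<open>\<zeta>\<close> becomes a column of the
    determinant.\<close>
  have "((\<lambda>q. exp (q $ 3) * (f + l1 * (q $ 1 - p $ 1) + l2 * (q $ 2 - p $ 2) + l3 * (q $ 3 - p $ 3)))
      has_derivative (\<lambda>h. exp (p $ 3) * (l1 * h $ 1 + l2 * h $ 2 + (l3 + f) * h $ 3))) (at p)"
    by (rule derivative_eq_intros n | simp add: algebra_simps)+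
  then show ?thesis
    by (rule has_derivative_transform_eventually)
      (use assms eventually_nhds_x_imp_x[OF assms] in \<open>auto simp: eventually_nhds_conv_at elim: eventually_mono\<close>)
qed

lemma zorich_like_derivative_inside:
  assumes "\<bar>p $ 1\<bar> < cap (p $ 2) (p $ 3)"
  shows "\<exists>M::real^3^3. det M \<ge> 1/2 \<and> (\<forall>i j. \<bar>M $ i $ j\<bar> \<le> 3) \<and>
    (\<forall>i. ((\<lambda>q. zorich_like q $ i) has_derivative (\<lambda>h. exp (p $ 3) * (M *v h) $ i)) (at p))"
proof -
  have pos: "cap (p $ 2) (p $ 3) > 0" using assms by linarith
  note t = cap_posD[OF pos]
  have op: "open {q::real^3. \<bar>q $ 1\<bar> < cap (q $ 2) (q $ 3)}"
    using locally_lipschitz_imp_continuous_on[OF locally_lipschitz_cap]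
    by (intro open_Collect_less continuous_intros)
  have "\<forall>\<^sub>F q in nhds p. \<bar>q $ 1\<bar> < cap (q $ 2) (q $ 3)"
    using eventually_nhds_in_open[OF op, of p] assms by simp
  then have ev: "\<forall>\<^sub>F q in nhds p. zorich_like q = exp (q $ 3) *\<^sub>R vector [- q $ 3, q $ 2, q $ 1]"
    by (rule eventually_mono) (rule zorich_like_inside)
  define M :: "real^3^3" where "M = vector [vector [0, 0, -1 - p $ 3], vector [0, 1, p $ 2], vector [1, 0, p $ 1]]"
  show ?thesis
  proof (intro exI[of _ M] conjI allI)
    \<comment> \<open>The determinant is \<open>1 + t\<close>, and \<open>|t| < 1/2\<close> in the
      inner region.\<close>
    show "det M \<ge> 1/2" using t by (simp add: M_def det_3)
    have "\<forall>i j. \<bar>M $ i $ j\<bar> \<le> 3"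
      unfolding forall_3 using t assms by (simp add: M_def)
    then show "\<bar>M $ i $ j\<bar> \<le> 3" for i j by blast
    have mv: "(M *v h) $ 1 = 0 * h $ 1 + 0 * h $ 2 + (-1 + (- p $ 3)) * h $ 3"
      "(M *v h) $ 2 = 0 * h $ 1 + 1 * h $ 2 + (0 + p $ 2) * h $ 3"
      "(M *v h) $ 3 = 1 * h $ 1 + 0 * h $ 2 + (0 + p $ 1) * h $ 3" for h
      by (simp_all add: matrix_vector_mult_def sum_3 M_def)
    have d: "((\<lambda>q. zorich_like q $ 1) has_derivative (\<lambda>h. exp (p $ 3) * (0 * h $ 1 + 0 * h $ 2 + (-1 + (- p $ 3)) * h $ 3))) (at p)"
      "((\<lambda>q. zorich_like q $ 2) has_derivative (\<lambda>h. exp (p $ 3) * (0 * h $ 1 + 1 * h $ 2 + (0 + p $ 2) * h $ 3))) (at p)"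
      "((\<lambda>q. zorich_like q $ 3) has_derivative (\<lambda>h. exp (p $ 3) * (1 * h $ 1 + 0 * h $ 2 + (0 + p $ 1) * h $ 3))) (at p)"
      by (rule exp_affine_has_derivative; rule eventually_mono[OF ev]; simp)+
    have "\<forall>i. ((\<lambda>q. zorich_like q $ i) has_derivative (\<lambda>h. exp (p $ 3) * (M *v h) $ i)) (at p)"
      unfolding forall_3 mv by (intro conjI d)
    then show "((\<lambda>q. zorich_like q $ i) has_derivative (\<lambda>h. exp (p $ 3) * (M *v h) $ i)) (at p)" for i
      by blast
  qed
qed

lemma zorich_like_derivative_outside:
  assumes out: "\<bar>p $ 1\<bar> > cap (p $ 2) (p $ 3)" and p: "generic p"
  shows "\<exists>M::real^3^3. det M \<ge> 1/2 \<and> (\<forall>i j. \<bar>M $ i $ j\<bar> \<le> 3) \<and>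
    (\<forall>i. ((\<lambda>q. zorich_like q $ i) has_derivative (\<lambda>h. exp (p $ 3) * (M *v h) $ i)) (at p))"
proof -
  define X where "X = sheared p"
  have X: "X = \<bar>p $ 1\<bar> + (wall (p $ 2) (p $ 3) - cap (p $ 2) (p $ 3))"
    unfolding X_def using out by (intro zorich_like_outside) simp
  have gen: "real_of_int i * X + real_of_int j * p $ 2 \<noteq> real_of_int k" if "i > 0" for i j k
    using p that unfolding X by (rule genericD(7))
  have geny: "p $ 2 \<noteq> real_of_int k" for k using p by (rule genericD(3))
  obtain a1 a2 v1 v2 w1 w2 e where e: "e > 0"
    and bd: "\<bar>a1\<bar> \<le> 1" "\<bar>a2\<bar> \<le> 1" "\<bar>v1\<bar> \<le> 1" "\<bar>v2\<bar> \<le> 1" "\<bar>w1\<bar> \<le> 1" "\<bar>w2\<bar> \<le> 1"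
    and det: "det3 a1 a2 (fold_A X (p $ 2) - 1/2) v1 v2 (fold_V X (p $ 2)) w1 w2 (fold_W X (p $ 2)) = 1/2"
    and aff: "\<forall>x' y'. \<bar>x' - X\<bar> < e \<longrightarrow> \<bar>y' - p $ 2\<bar> < e \<longrightarrow>
      fold_A x' y' = fold_A X (p $ 2) + a1 * (x' - X) + a2 * (y' - p $ 2) \<and>
      fold_V x' y' = fold_V X (p $ 2) + v1 * (x' - X) + v2 * (y' - p $ 2) \<and>
      fold_W x' y' = fold_W X (p $ 2) + w1 * (x' - X) + w2 * (y' - p $ 2)"
    by (rule exE[OF fold_locally_affine[of X "p $ 2"]], rule gen, assumption, rule geny, elim exE conjE) (rule that; assumption)
  have "p $ 2 \<noteq> 0" "\<bar>p $ 2\<bar> \<noteq> 1" using geny[of 0] geny[of 1] geny[of "-1"] by auto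
  from wall_cap_locally_affine[OF this genericD(4-6)[OF p]]
  obtain b1 b2 d where d: "d > 0" and bb: "\<bar>b1\<bar> \<le> 2" "\<bar>b2\<bar> \<le> 2"
    and baff: "\<forall>y' t'. \<bar>y' - p $ 2\<bar> < d \<longrightarrow> \<bar>t' - p $ 3\<bar> < d \<longrightarrow>
      wall y' t' - cap y' t' = wall (p $ 2) (p $ 3) - cap (p $ 2) (p $ 3) + b1 * (y' - p $ 2) + b2 * (t' - p $ 3)"
    by (elim exE conjE) (rule that; assumption)
  define s where "s = sgn (p $ 1)"
  have s: "s = 1 \<or> s = -1" "\<bar>p $ 1\<bar> = s * p $ 1"
    using genericD(1)[OF p] unfolding s_def by (auto simp: sgn_real_def)
  have ss: "s * s = 1" using s(1) by auto
  define A V W where "A = fold_A X (p $ 2) - 1/2" and "V = fold_V X (p $ 2)" and "W = fold_W X (p $ 2)"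
  have near_nth: "\<forall>\<^sub>F q in nhds p. \<bar>q $ i - p $ i\<bar> < r" if "r > 0" for r and i :: 3
    unfolding eventually_nhds_metric
  proof (intro exI[of _ r] conjI allI impI that)
    fix q assume "dist q p < r"
    then show "\<bar>q $ i - p $ i\<bar> < r" using component_le_norm_cart[of "q - p" i] by (simp add: dist_norm)
  qed
  have op: "open {q. \<bar>sheared q - X\<bar> < e}" "open {q::real^3. cap (q $ 2) (q $ 3) < \<bar>q $ 1\<bar>}"
    using locally_lipschitz_imp_continuous_on[OF locally_lipschitz_sheared]
      locally_lipschitz_imp_continuous_on[OF locally_lipschitz_cap]
    by (intro open_Collect_less continuous_intros; simp)+
  have "\<forall>\<^sub>F q in nhds p. \<bar>sheared q - X\<bar> < e" "\<forall>\<^sub>F q in nhds p. cap (q $ 2) (q $ 3) < \<bar>q $ 1\<bar>"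
    using eventually_nhds_in_open[OF op(1), of p] eventually_nhds_in_open[OF op(2), of p] e out
    by (simp_all add: X_def)
  \<comment> \<open>Here the first coordinate keeps its sign \<open>s\<close>, so the reflection is
    linear near \<open>p\<close>.\<close>
  moreover have "\<forall>\<^sub>F q in nhds p. \<bar>q $ 1 - p $ 1\<bar> < \<bar>p $ 1\<bar>"
    using near_nth[of "\<bar>p $ 1\<bar>" 1] genericD(1)[OF p] by simp
  ultimately have ev: "\<forall>\<^sub>F q in nhds p. zorich_like q = exp (q $ 3) *\<^sub>R vector
      [A + a1 * s * (q $ 1 - p $ 1) + (a2 + b1 * a1) * (q $ 2 - p $ 2) + b2 * a1 * (q $ 3 - p $ 3),
       V + v1 * s * (q $ 1 - p $ 1) + (v2 + b1 * v1) * (q $ 2 - p $ 2) + b2 * v1 * (q $ 3 - p $ 3),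
       s * W + w1 * (q $ 1 - p $ 1) + s * (w2 + b1 * w1) * (q $ 2 - p $ 2) + s * b2 * w1 * (q $ 3 - p $ 3)]"
    using near_nth[OF e, of 2] near_nth[OF d, of 2] near_nth[OF d, of 3]
  proof eventually_elim
    case (elim q)
    have sq: "sgn (q $ 1) = s" using elim(3) unfolding s_def by (auto simp: sgn_real_def)
    then have absq: "\<bar>q $ 1\<bar> = s * q $ 1" by (metis abs_sgn mult.commute)
    have le: "cap (q $ 2) (q $ 3) \<le> \<bar>q $ 1\<bar>" using elim(2) by simp
    have shq: "sheared q - X = s * (q $ 1 - p $ 1) + b1 * (q $ 2 - p $ 2) + b2 * (q $ 3 - p $ 3)"
      unfolding zorich_like_outside(1)[OF le] X absq s(2) baff[rule_format, OF elim(5,6)] by (simp add: algebra_simps)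
    have f: "fold_A (sheared q) (q $ 2) - 1/2 = A + a1 * (sheared q - X) + a2 * (q $ 2 - p $ 2)"
      "fold_V (sheared q) (q $ 2) = V + v1 * (sheared q - X) + v2 * (q $ 2 - p $ 2)"
      "fold_W (sheared q) (q $ 2) = W + w1 * (sheared q - X) + w2 * (q $ 2 - p $ 2)"
      unfolding A_def V_def W_def using aff[rule_format, OF elim(1,4)] by simp_all
    have ssr: "s * (s * r) = r" for r using ss by (simp flip: mult.assoc)
    have "s * fold_W (sheared q) (q $ 2) =
      s * W + w1 * (q $ 1 - p $ 1) + s * (w2 + b1 * w1) * (q $ 2 - p $ 2) + s * b2 * w1 * (q $ 3 - p $ 3)"
      unfolding f shq by (simp add: algebra_simps ssr)
    moreover have "fold_A (sheared q) (q $ 2) - 1/2 =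
       A + a1 * s * (q $ 1 - p $ 1) + (a2 + b1 * a1) * (q $ 2 - p $ 2) + b2 * a1 * (q $ 3 - p $ 3)"
      unfolding f shq by (simp add: algebra_simps)
    moreover have "fold_V (sheared q) (q $ 2) =
       V + v1 * s * (q $ 1 - p $ 1) + (v2 + b1 * v1) * (q $ 2 - p $ 2) + b2 * v1 * (q $ 3 - p $ 3)"
      unfolding f shq by (simp add: algebra_simps)
    ultimately show ?case unfolding zorich_like_outside(2)[OF le] sq by simp
  qed
  \<comment> \<open>Chain rule: compared with the matrix of the folding, columns 2 and 3 gain
    \<open>b1\<close> and \<open>b2\<close> times column 1, while \<open>s\<close> multiplies column
    1 and row 3. Neither operation changes the determinant.\<close>
  define M :: "real^3^3" where "M = vector [vector [a1 * s, a2 + b1 * a1, b2 * a1 + A],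
    vector [v1 * s, v2 + b1 * v1, b2 * v1 + V], vector [w1, s * (w2 + b1 * w1), s * b2 * w1 + s * W]]"
  show ?thesis
  proof (intro exI[of _ M] conjI allI)
    have ssr: "s * (s * r) = r" for r using ss by (simp flip: mult.assoc)
    have "det M = det3 a1 a2 A v1 v2 V w1 w2 W"
      by (simp add: M_def det_3 det3_def algebra_simps ssr)
    then show "det M \<ge> 1/2" using det by (simp add: A_def V_def W_def)
    have as: "\<bar>s\<bar> = 1" using s(1) by auto
    \<comment> \<open>The entry bound 3 is \<open>1 + 2 * 1\<close>, with slopes of the folding at
      most 1 and slopes of the shear at most 2.\<close>
    have m3: "\<bar>a + b * c\<bar> \<le> 3" if "\<bar>a\<bar> \<le> 1" "\<bar>b\<bar> \<le> 2" "\<bar>c\<bar> \<le> 1" for a b c :: real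
      using abs_triangle_ineq[of a "b * c"] mult_mono[OF that(2,3)] that(1) by (simp add: abs_mult)
    have m3': "\<bar>b * c + a\<bar> \<le> 3" if "\<bar>a\<bar> \<le> 1" "\<bar>b\<bar> \<le> 2" "\<bar>c\<bar> \<le> 1" for a b c :: real
      using m3[OF that] by (simp only: add.commute)
    have AVW: "\<bar>A\<bar> \<le> 1" "\<bar>V\<bar> \<le> 1" "\<bar>W\<bar> \<le> 1"
      unfolding A_def V_def W_def using fold_bounds(1,2)[of X "p $ 2"] by (linarith, intro fold_bounds, intro fold_bounds)
    have third: "s * b2 * w1 + s * W = s * (b2 * w1 + W)" by (simp add: algebra_simps)
    have le3: "\<bar>r\<bar> \<le> 3" if "\<bar>r\<bar> \<le> 1" for r :: real using that by linarith
    have "\<forall>i j. \<bar>M $ i $ j\<bar> \<le> 3"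
      unfolding forall_3 M_def vector_3 third abs_mult[of s] abs_mult[of _ s] as mult_1 mult_1_right
      by (intro conjI m3 m3' le3 bd bb AVW)
    then show "\<bar>M $ i $ j\<bar> \<le> 3" for i j by blast
    have mv: "(M *v h) $ 1 = a1 * s * h $ 1 + (a2 + b1 * a1) * h $ 2 + (b2 * a1 + A) * h $ 3"
      "(M *v h) $ 2 = v1 * s * h $ 1 + (v2 + b1 * v1) * h $ 2 + (b2 * v1 + V) * h $ 3"
      "(M *v h) $ 3 = w1 * h $ 1 + s * (w2 + b1 * w1) * h $ 2 + (s * b2 * w1 + s * W) * h $ 3" for h
      by (simp_all add: matrix_vector_mult_def sum_3 M_def)
    have d: "((\<lambda>q. zorich_like q $ 1) has_derivative (\<lambda>h. exp (p $ 3) * (a1 * s * h $ 1 + (a2 + b1 * a1) * h $ 2 + (b2 * a1 + A) * h $ 3))) (at p)"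
      "((\<lambda>q. zorich_like q $ 2) has_derivative (\<lambda>h. exp (p $ 3) * (v1 * s * h $ 1 + (v2 + b1 * v1) * h $ 2 + (b2 * v1 + V) * h $ 3))) (at p)"
      "((\<lambda>q. zorich_like q $ 3) has_derivative (\<lambda>h. exp (p $ 3) * (w1 * h $ 1 + s * (w2 + b1 * w1) * h $ 2 + (s * b2 * w1 + s * W) * h $ 3))) (at p)"
      by (rule exp_affine_has_derivative; rule eventually_mono[OF ev]; simp)+
    have "\<forall>i. ((\<lambda>q. zorich_like q $ i) has_derivative (\<lambda>h. exp (p $ 3) * (M *v h) $ i)) (at p)"
      unfolding forall_3 mv by (intro conjI d)
    then show "((\<lambda>q. zorich_like q $ i) has_derivative (\<lambda>h. exp (p $ 3) * (M *v h) $ i)) (at p)" for i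
      by blast
  qed
qed

section \<open>Quasiregularity and transcendence\<close>

lemma AE_zorich_like_derivative:
  "AE p in lebesgue. \<exists>M::real^3^3. det M \<ge> 1/2 \<and> (\<forall>i j. \<bar>M $ i $ j\<bar> \<le> 3) \<and>
    (\<forall>i. ((\<lambda>q. zorich_like q $ i) has_derivative (\<lambda>h. exp (p $ 3) * (M *v h) $ i)) (at p))"
  using AE_generic
proof eventually_elim
  case (elim p)
  then have "\<bar>p $ 1\<bar> \<noteq> cap (p $ 2) (p $ 3)" unfolding generic_def by blast
  then consider "\<bar>p $ 1\<bar> < cap (p $ 2) (p $ 3)" | "\<bar>p $ 1\<bar> > cap (p $ 2) (p $ 3)" by linarith
  then show ?case
  proof cases
    case 1 then show ?thesis by (rule zorich_like_derivative_inside)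
  next
    case 2 then show ?thesis using elim by (rule zorich_like_derivative_outside)
  qed
qed

text \<open>Made of limits of difference quotients, so that its entries are Borel functions and weak
  derivatives; almost everywhere it is \<open>exp t\<close> times the matrix \<open>M\<close> found
  above.\<close>

definition zorich_like_matrix :: "real^3 \<Rightarrow> real^3^3" where
  "zorich_like_matrix p = (\<chi> i j. directional_derivative (\<lambda>q. zorich_like q $ i) (axis j 1) p)"

lemma zorich_like_difference_quotient:
  assumes "\<And>i. ((\<lambda>q. zorich_like q $ i) has_derivative (\<lambda>h. exp (p $ 3) * (M *v h) $ i)) (at p)"
  shows "(\<lambda>n. (zorich_like (p + axis j 1 /\<^sub>R real (Suc n)) $ i - zorich_like p $ i) * real (Suc n))
      \<longlonglongrightarrow> exp (p $ 3) * M $ i $ j"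
    and "directional_derivative (\<lambda>q. zorich_like q $ i) (axis j 1) p = exp (p $ 3) * M $ i $ j"
proof -
  have "(M *v axis j 1) $ i = M $ i $ j"
    by (simp add: matrix_vector_mult_basis column_def)
  then show lim: "(\<lambda>n. (zorich_like (p + axis j 1 /\<^sub>R real (Suc n)) $ i - zorich_like p $ i) * real (Suc n))
      \<longlonglongrightarrow> exp (p $ 3) * M $ i $ j"
    using difference_quotient_tendsto[OF assms, of "axis j 1" i] by simp
  show "directional_derivative (\<lambda>q. zorich_like q $ i) (axis j 1) p = exp (p $ 3) * M $ i $ j"
    unfolding directional_derivative_def using lim by (rule limI)
qed

lemma AE_zorich_like_difference_quotient:
  "AE p in lebesgue. (\<lambda>n. (zorich_like (p + axis j 1 /\<^sub>R real (Suc n)) $ i - zorich_like p $ i) * real (Suc n))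
      \<longlonglongrightarrow> directional_derivative (\<lambda>q. zorich_like q $ i) (axis j 1) p"
  using AE_zorich_like_derivative
proof eventually_elim
  case (elim p)
  then obtain M :: "real^3^3" where
    M: "\<And>i. ((\<lambda>q. zorich_like q $ i) has_derivative (\<lambda>h. exp (p $ 3) * (M *v h) $ i)) (at p)"
    by blast
  show ?case using zorich_like_difference_quotient[OF M] by simp
qed

lemma norm_matrix_vector_le:
  fixes M :: "real^3^3"
  assumes "\<And>i j. \<bar>M $ i $ j\<bar> \<le> B"
  shows "norm (M *v h) \<le> 9 * B * norm h"
proof -
  have B: "B \<ge> 0" using assms[of 1 1] by linarith
  have "\<bar>(M *v h) $ i\<bar> \<le> 3 * B * norm h" for i
  proof -
    have "\<bar>(M *v h) $ i\<bar> \<le> (\<Sum>j\<in>UNIV. \<bar>M $ i $ j * h $ j\<bar>)"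
      unfolding matrix_vector_mult_def by simp
    also have "\<dots> \<le> (\<Sum>j\<in>(UNIV::3 set). B * norm h)"
      unfolding abs_mult by (intro sum_mono mult_mono assms component_le_norm_cart B) auto
    finally show ?thesis by simp
  qed
  then have "(\<Sum>i\<in>UNIV. \<bar>(M *v h) $ i\<bar>) \<le> (\<Sum>i\<in>(UNIV::3 set). 3 * B * norm h)"
    by (intro sum_mono)
  then show ?thesis using norm_le_l1_cart[of "M *v h"] by simp
qed

text \<open>Entries of size at most \<open>3 * exp t\<close> bound the operator norm by
  \<open>27 * exp t\<close>, while the determinant is at least \<open>exp (3 * t) / 2\<close>; this
  gives the constant.\<close>

lemma zorich_like_distortion:
  "AE p in lebesgue. p \<in> UNIV \<longrightarrow>
     (SUP h\<in>sphere 0 1. norm (zorich_like_matrix p *v h)) ^ CARD(3) \<le> (2 * 27 ^ 3) * det (zorich_like_matrix p)"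
  using AE_zorich_like_derivative
proof eventually_elim
  case (elim p)
  then obtain M :: "real^3^3" where d: "det M \<ge> 1/2" and bd: "\<And>i j. \<bar>M $ i $ j\<bar> \<le> 3" and
    M: "\<And>i. ((\<lambda>q. zorich_like q $ i) has_derivative (\<lambda>h. exp (p $ 3) * (M *v h) $ i)) (at p)"
    by blast
  let ?D = "zorich_like_matrix p" and ?e = "exp (p $ 3)"
  have D: "?D $ i $ j = ?e * M $ i $ j" for i j
    unfolding zorich_like_matrix_def using zorich_like_difference_quotient(2)[OF M] by simp
  have detD: "det ?D = ?e ^ 3 * det M"
    unfolding det_3 D by (simp add: power3_eq_cube algebra_simps)
  have "\<bar>?D $ i $ j\<bar> \<le> ?e * 3" for i j
    unfolding D abs_mult using bd by simp
  note bdD = norm_matrix_vector_le[OF this]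
  have le: "norm (?D *v h) \<le> 27 * ?e" if "h \<in> sphere 0 1" for h
    using bdD[of h] that by simp
  have ax: "(axis 1 1 :: real^3) \<in> sphere 0 1" by (simp add: norm_axis_1)
  have "(SUP h\<in>sphere 0 1. norm (?D *v h)) \<le> 27 * ?e"
    using ax le by (intro cSUP_least) auto
  \<comment> \<open>Raising to the third power requires a nonnegative supremum; one unit vector
    supplies the lower bound.\<close>
  moreover have "0 \<le> norm (?D *v axis 1 1)" by simp
  then have "0 \<le> (SUP h\<in>sphere 0 1. norm (?D *v h))"
    by (rule cSUP_upper2[OF _ ax, rotated]) (use le in \<open>auto intro!: bdd_aboveI\<close>)
  ultimately have "(SUP h\<in>sphere 0 1. norm (?D *v h)) ^ 3 \<le> (27 * ?e) ^ 3"
    by (rule power_mono)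
  also have "\<dots> = (2 * 27 ^ 3) * (?e ^ 3 * (1/2))"
    by (simp add: power_mult_distrib)
  also have "\<dots> \<le> (2 * 27 ^ 3) * det ?D"
    unfolding detD using d by (intro mult_left_mono) auto
  finally show ?case by simp
qed

lemma quasiregular_zorich_like: "quasiregular_on UNIV zorich_like"
proof -
  have wp: "weak_partial UNIV (axis j 1) (\<lambda>p. zorich_like p $ i)
      (directional_derivative (\<lambda>q. zorich_like q $ i) (axis j 1))"
    and Lp: "locally_Lp k UNIV (directional_derivative (\<lambda>q. zorich_like q $ i) (axis j 1))" for i j k
    using AE_zorich_like_difference_quotient locally_lipschitz_zorich_like
    by (intro weak_partial_directional_derivative directional_derivative_locally_Lp; simp add: axis_in_Basis_iff)+
  have "sobolev_1_loc CARD(3) UNIV (\<lambda>p. zorich_like p $ i)" for i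
    unfolding sobolev_1_loc_def
  proof (intro conjI ballI)
    show "locally_Lp CARD(3) UNIV (\<lambda>p. zorich_like p $ i)"
      using locally_lipschitz_zorich_like by (rule locally_lipschitz_imp_locally_Lp)
    fix b :: "real^3" assume "b \<in> Basis"
    then obtain j where "b = axis j 1" by (auto simp: Basis_vec_def)
    then show "\<exists>v. weak_partial UNIV b (\<lambda>p. zorich_like p $ i) v \<and> locally_Lp CARD(3) UNIV v"
      using wp Lp by blast
  qed
  moreover have "formal_derivative UNIV zorich_like zorich_like_matrix"
    unfolding formal_derivative_def zorich_like_matrix_def using wp by simp
  moreover have "continuous_on UNIV zorich_like"
    using continuous_on_vec_lambda[of UNIV "\<lambda>i p. zorich_like p $ i"]
      locally_lipschitz_imp_continuous_on[OF locally_lipschitz_zorich_like] by simp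
  moreover have "(1::real) \<le> 2 * 27 ^ 3" by simp
  ultimately show ?thesis
    unfolding quasiregular_on_def using zorich_like_distortion by (auto intro!: exI[of _ "2 * 27 ^ 3"])
qed

section \<open>The essential singularity at infinity\<close>

lemma zorich_like_large:
  assumes "t \<ge> 1/2"
  shows "norm (zorich_like (vector [1/2, 0, t])) \<ge> exp t / 2"
proof -
  let ?p = "vector [1/2, 0, t] :: real^3"
  have w: "wall 0 t = 0" "cap 0 t = 0" using assms by (auto simp: wall_def cap_def)
  have out: "cap (?p $ 2) (?p $ 3) \<le> \<bar>?p $ 1\<bar>" by (simp add: w)
  \<comment> \<open>For \<open>t \<ge> 1/2\<close> the shear is trivial, and the vertical line runs
    through the centre of \<open>B\<close>, below the apex of height \<open>1/2\<close>.\<close>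
  have sh: "sheared ?p = 1/2" unfolding zorich_like_outside(1)[OF out] by (simp add: w)
  have "zorich_like ?p $ 3 = exp t / 2"
    unfolding zorich_like_outside(2)[OF out] sh using fold_base(3)[of "1/2" 0] by simp
  then show ?thesis using component_le_norm_cart[of "zorich_like ?p" 3] by simp
qed

lemma zorich_like_small:
  assumes "t \<le> -1/2"
  shows "norm (zorich_like (vector [1/2, 0, t])) \<le> 3"
proof -
  let ?p = "vector [1/2, 0, t] :: real^3"
  have w: "cap 0 t = 0" using assms by (auto simp: wall_def cap_def)
  have out: "cap (?p $ 2) (?p $ 3) \<le> \<bar>?p $ 1\<bar>" by (simp add: w)
  have e: "exp t \<le> 1" using assms by simp
  have m: "\<bar>exp t * r\<bar> \<le> 1" if "\<bar>r\<bar> \<le> 1" for r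
    using mult_mono[OF e that] by (simp add: abs_mult)
  note b = fold_bounds[of "sheared ?p" 0]
  have "\<bar>fold_A (sheared ?p) 0 - 1/2\<bar> \<le> 1" using b(1,2) by linarith
  then have "\<bar>zorich_like ?p $ 1\<bar> \<le> 1" "\<bar>zorich_like ?p $ 2\<bar> \<le> 1" "\<bar>zorich_like ?p $ 3\<bar> \<le> 1"
    unfolding zorich_like_outside(2)[OF out] using m b by simp_all
  then show ?thesis using norm_le_l1_cart[of "zorich_like ?p"] by (simp add: sum_3)
qed

text \<open>On the vertical line through \<open>(1/2, 0)\<close> the map tends to infinity as
  \<open>t\<close> increases and stays bounded as \<open>t\<close> decreases, which excludes finite
  limits and infinity respectively.\<close>

lemma transcendental_zorich_like: "transcendental_type zorich_like"
  unfolding transcendental_type_def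
proof
  assume "\<exists>l. limitin (Alexandroff_compactification euclidean) (\<lambda>x. Some (zorich_like x)) l at_infinity"
  then obtain l where l: "limitin (Alexandroff_compactification euclidean) (\<lambda>x. Some (zorich_like x)) l at_infinity"
    by blast
  have far: "b \<le> norm (vector [1/2, 0, t] :: real^3)" if "b \<le> \<bar>t\<bar>" for b t
    using component_le_norm_cart[of "vector [1/2, 0, t] :: real^3" 3] that by simp
  show False
  proof (cases l)
    case None
    \<comment> \<open>The neighbourhood of infinity that avoids the ball containing the values at
      very negative \<open>t\<close>.\<close>
    have "openin (Alexandroff_compactification euclidean) (insert None (Some ` (UNIV - cball 0 3 :: (real^3) set)))"
      unfolding openin_Alexandroff_compactification
      by (intro disjI2 exI[of _ "cball 0 3"]) auto
    then have "\<forall>\<^sub>F x in at_infinity. Some (zorich_like x) \<in> insert None (Some ` (UNIV - cball 0 3))"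
      using l unfolding limitin_def None by blast
    then obtain b where "\<forall>x. b \<le> norm x \<longrightarrow> Some (zorich_like x) \<in> insert None (Some ` (UNIV - cball 0 3))"
      unfolding eventually_at_infinity by blast
    then have b: "\<forall>x. b \<le> norm x \<longrightarrow> \<not> norm (zorich_like x) \<le> 3"
      by force
    have "b \<le> norm (vector [1/2, 0, - (\<bar>b\<bar> + 1)] :: real^3)" by (rule far) simp
    moreover have "- (\<bar>b\<bar> + 1) \<le> -1/2" by simp
    ultimately show False using b zorich_like_small by blast
  next
    case (Some y)
    have "openin (Alexandroff_compactification euclidean) (Some ` ball y 1)"
      by simp
    moreover have "Some y \<in> Some ` ball y 1" by simp
    ultimately have "\<forall>\<^sub>F x in at_infinity. Some (zorich_like x) \<in> Some ` ball y 1"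
      using l unfolding limitin_def Some by blast
    then obtain b where "\<forall>x. b \<le> norm x \<longrightarrow> Some (zorich_like x) \<in> Some ` ball y 1"
      unfolding eventually_at_infinity by blast
    then have b: "\<forall>x. b \<le> norm x \<longrightarrow> zorich_like x \<in> ball y 1"
      by blast
    \<comment> \<open>Chosen so that the point lies beyond \<open>b\<close> and
      \<open>exp t / 2 \<ge> (1 + t) / 2 \<ge> norm y + 1\<close>.\<close>
    define t where "t = \<bar>b\<bar> + 1 + 2 * norm y"
    have t: "t \<ge> 1/2" "b \<le> \<bar>t\<bar>" unfolding t_def using norm_ge_zero[of y] by linarith+
    have "norm (zorich_like (vector [1/2, 0, t]) - y) < 1"
      using b far[OF t(2)] by (auto simp: dist_norm norm_minus_commute)
    then have "norm (zorich_like (vector [1/2, 0, t])) < norm y + 1"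
      using norm_triangle_sub[of "zorich_like (vector [1/2, 0, t])" y] by linarith
    moreover have "(1 + t) / 2 \<le> exp t / 2"
      by (intro divide_right_mono exp_ge_add_one_self) simp
    moreover have "norm y + 1 \<le> (1 + t) / 2" unfolding t_def by simp
    ultimately show False using zorich_like_large[OF t(1)] by linarith
  qed
qed

theorem theorem1p1:
  shows "\<exists>F :: real^3 \<Rightarrow> real^3.
           quasiregular_on UNIV F \<and> transcendental_type F \<and> (\<forall>x. F x = 0 \<longleftrightarrow> x = 0)"
  using quasiregular_zorich_like transcendental_zorich_like zorich_like_eq_0_iff by blast

end
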